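(* $\chi(\mathbb{E}^5)\le 140$, $\chi(\mathbb{E}^7)\le 1372$, and $\chi(\mathbb{E}^{9})\le 17253$.
   Context: For $A\subseteq \mathbb{E}^n$ (Euclidean $n$-space), $\chi(A)$ denotes the chromatic number of $A$: the least number of colors needed to color the points of $A$ so that any two points of $A$ at Euclidean distance exactly $1$ receive different colors. *)

theory Defs
  imports "HOL-Analysis.Analysis" "HOL-Library.Extended_Nat"
begin

definition unit_dist_colorable :: "'a::euclidean_space set \<Rightarrow> nat \<Rightarrow> bool" where
  "unit_dist_colorable A k \<longleftrightarrow>
     (\<exists>c :: 'a \<Rightarrow> nat. c ` A \<subseteq> {..<k} \<and> (\<forall>x\<in>A. \<forall>y\<in>A. dist x y = 1 \<longrightarrow> c x \<noteq> c y))"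

text \<open>The value is \<open>\<infinity>\<close> if no finite number of colors suffices (infimum of the empty
  set); otherwise the infimum is attained, so it is the least such number.\<close>

definition chromatic_number :: "'a::euclidean_space set \<Rightarrow> enat" where
  "chromatic_number A = (INF k \<in> {k. unit_dist_colorable A k}. enat k)"

end

theory Submission
  imports Defs
begin

text \<open>A point of a Euclidean space gets the colour of a nearest point of a lattice \<open>L\<close> modulo a sublattice
  \<open>L'\<close>. This avoids a distance \<open>D\<close> that exceeds the diameter of the Voronoi cell \<open>V\<close> of \<open>L\<close> and is less than
  the distance between \<open>V\<close> and its translates by nonzero vectors of \<open>L'\<close>; the latter distance is bounded below
  by means of linear functionals. In dimension 5, \<open>L\<close> is the dual of \<open>A\<^sub>5\<close>, with a sublattice of index 140.
  In dimensions 7 and 9, the space is cut into layers which are coloured along the dual of \<open>E\<^sub>6\<close>, respectively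
  \<open>E\<^sub>8\<close>, with four palettes used cyclically. These lattices are modules over the Eisenstein integers, and
  \<open>L'\<close> is the multiple of \<open>L\<close> by an element of norm 7, so that \<open>4 \<cdot> 7\<^sup>3 = 1372\<close>, respectively
  \<open>4 \<cdot> 7\<^sup>4 = 9604\<close>, colours suffice.\<close>

section \<open>Sublattice colourings\<close>

text \<open>Narrow margins shape the proof. In \<open>E8\<close> and in the dual of
  \<open>E6\<close> the minimal vectors have squared norm 2 and the covering radius is at most 1, so
  a cell has diameter up to 2, while the sublattice starts at squared norm 14. The triangle
  inequality keeps cells of equal colour only sqrt 14 - 2 < 2 apart; a functional improves this to
  sqrt (14/3) > 2. The room between 4 and 14/3 pays for the additional dimension. Layers of
  thickness h require 4 + h^2 < 14/3 and, with four palettes, 4 + h^2 < (3 h)^2, that is, h^2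
  strictly between 1/2 and 2/3. Three palettes would require 4 + h^2 < (2 h)^2, that is, h^2 > 4/3,
  so four is the least number for which this works. In dimension 5 the cell has diameter 2 sqrt
  (35/72) = 1.3944..., barely below the avoided distance 7/5, and a finite check of the short
  sublattice vectors takes the place of the Eisenstein structure.\<close>

lemma chromatic_number_le:
  "unit_dist_colorable A k \<Longrightarrow> chromatic_number A \<le> enat k"
  unfolding chromatic_number_def by (rule INF_lower) simp

lemma unit_dist_colorable_mono:
  "unit_dist_colorable A j \<Longrightarrow> j \<le> k \<Longrightarrow> unit_dist_colorable A k"
  unfolding unit_dist_colorable_def by (meson lessThan_subset_iff subset_trans)

text \<open>A linear isometry onto \<open>S\<close> followed by the dilation by \<open>D\<close>
  turns distance 1 into \<open>D\<close>. So every lattice can keep its natural scale and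
  coordinates, including those in a hyperplane of a larger space.\<close>

lemma unit_dist_colorable_transfer:
  fixes S :: "'b::euclidean_space set" and c :: "'b \<Rightarrow> nat"
  assumes S: "subspace S" "dim S = DIM('a::euclidean_space)" and D: "D > 0"
    and c: "\<And>p. p \<in> S \<Longrightarrow> c p < k"
      "\<And>p q. p \<in> S \<Longrightarrow> q \<in> S \<Longrightarrow> dist p q = D \<Longrightarrow> c p \<noteq> c q"
  shows "unit_dist_colorable (UNIV :: 'a set) k"
proof -
  obtain f :: "'a \<Rightarrow> 'b" and g where f: "linear f" "f ` UNIV = S" "\<And>x. norm (f x) = norm x"
    using isometries_subspaces[OF subspace_UNIV S(1)] S(2) by (metis UNIV_I dim_UNIV)
  have S_scaled: "D *\<^sub>R f x \<in> S" for x
    using f(2) S(1) subspace_scale by blast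
  have "dist (D *\<^sub>R f x) (D *\<^sub>R f y) = D" if "dist x y = 1" for x y
  proof -
    have "dist (D *\<^sub>R f x) (D *\<^sub>R f y) = D * norm (f (x - y))"
      using D by (simp add: dist_norm linear_diff[OF f(1)] flip: scaleR_diff_right)
    then show ?thesis using that by (simp add: f(3) dist_norm)
  qed
  then show ?thesis
    unfolding unit_dist_colorable_def
    by (intro exI[of _ "\<lambda>x. c (D *\<^sub>R f x)"]) (auto intro: c(1) S_scaled dest: c(2)[OF S_scaled S_scaled])
qed

lemma nearest_lattice_point:
  fixes L :: "'a::euclidean_space set"
  assumes ne: "L \<noteq> {}" and diff: "\<And>x y. x \<in> L \<Longrightarrow> y \<in> L \<Longrightarrow> x - y \<in> L"
    and e: "e > 0" "\<And>x. x \<in> L \<Longrightarrow> x \<noteq> 0 \<Longrightarrow> norm x \<ge> e"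
  obtains l where "l \<in> L" "\<And>v. v \<in> L \<Longrightarrow> dist p l \<le> dist p v"
    "\<And>v. v \<in> L \<Longrightarrow> (p - l) \<bullet> v \<le> (norm v)\<^sup>2 / 2"
proof -
  have "closed L"
    by (rule discrete_imp_closed[OF e(1)]) (use diff e(2) in \<open>force simp: dist_norm\<close>)
  then obtain l where l: "l \<in> L" "\<And>v. v \<in> L \<Longrightarrow> dist p l \<le> dist p v"
    using distance_attains_inf[OF _ ne] by metis
  have "(p - l) \<bullet> v \<le> (norm v)\<^sup>2 / 2" if "v \<in> L" for v
  proof -
    \<comment> \<open>This is \<open>l + v\<close>, written by means of differences, the only
      operation under which \<open>L\<close> is assumed closed.\<close>
    have "l - ((v - v) - v) \<in> L" using diff that l(1) by blast
    then have "dist p l \<le> dist p (l + v)" using l(2) by simp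
    then have "(norm (p - l))\<^sup>2 \<le> (norm ((p - l) - v))\<^sup>2"
      by (simp add: dist_norm diff_diff_eq)
    then show ?thesis
      by (simp add: power2_norm_eq_inner inner_diff inner_commute)
  qed
  with l that show ?thesis by blast
qed

lemma norm_sq_vec: "(norm x)\<^sup>2 = (\<Sum>i\<in>UNIV. (x $ i)\<^sup>2)" for x :: "real ^ 'n"
  unfolding power2_norm_eq_inner inner_vec_def by (simp add: power2_eq_square)

text \<open>Colours pack several residues into one number in mixed radix; repeated use of this lemma
  unpacks them.\<close>

lemma base_digit:
  fixes k a a' b b' :: int
  assumes "0 \<le> a" "a < k" "0 \<le> a'" "a' < k" "a + k * b = a' + k * b'"
  shows "a = a'" "b = b'"
proof -
  have "(a + k * b) mod k = a" "(a' + k * b') mod k = a'" using assms(1-4) by simp_all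
  then show "a = a'" using assms(5) by simp
  then show "b = b'" using assms by simp
qed

text \<open>\<open>\<tau>\<close> plays the role of multiplication by a primitive sixth root of unity, so \<open>2 + \<tau>\<close> is an
  element of norm 7 and \<open>\<kappa>\<close> separates the classes of \<open>L\<close> modulo \<open>(2 + \<tau>) L\<close>.\<close>

locale eisenstein_lattice =
  fixes L :: "'a::euclidean_space set" and \<tau> :: "'a \<Rightarrow> 'a" and \<kappa> :: "'a \<Rightarrow> nat" and K :: nat
  assumes diff: "\<And>x y. x \<in> L \<Longrightarrow> y \<in> L \<Longrightarrow> x - y \<in> L"
    and tau_mem: "\<And>x. x \<in> L \<Longrightarrow> \<tau> x \<in> L"
    and tau_norm: "\<And>x. norm (\<tau> x) = norm x"
    and tau_inner: "\<And>x. \<tau> x \<bullet> x = (norm x)\<^sup>2 / 2"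
    and norms: "\<And>x. x \<in> L \<Longrightarrow> x \<noteq> 0 \<Longrightarrow> (norm x)\<^sup>2 = 2 \<or> (norm x)\<^sup>2 \<ge> 3"
    and covering: "\<And>p. \<exists>l\<in>L. dist p l \<le> 1"
    and color_less: "\<And>x. \<kappa> x < K"
    and color_eq: "\<And>x y. x \<in> L \<Longrightarrow> y \<in> L \<Longrightarrow> \<kappa> x = \<kappa> y \<Longrightarrow> \<exists>r\<in>L. x - y = 2 *\<^sub>R r + \<tau> r"
begin

lemma zero_mem: "0 \<in> L"
  using covering diff by (metis diff_self)

lemma uminus_mem: "x \<in> L \<Longrightarrow> - x \<in> L"
  using diff[OF zero_mem] by simp

text \<open>The factor is the norm of the Eisenstein integer \<open>a + \<tau>\<close>: 7 for
  \<open>a = 2\<close> and 21 for \<open>a = 4\<close>.\<close>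

lemma norm_comb: "(norm (a *\<^sub>R r + \<tau> r))\<^sup>2 = (a\<^sup>2 + a + 1) * (norm r)\<^sup>2"
proof -
  have "\<tau> r \<bullet> \<tau> r = r \<bullet> r"
    using tau_norm by (metis power2_norm_eq_inner)
  moreover have "\<tau> r \<bullet> r = (r \<bullet> r) / 2" "r \<bullet> \<tau> r = (r \<bullet> r) / 2"
    using tau_inner[of r] by (simp_all add: power2_norm_eq_inner inner_commute)
  ultimately have "(a *\<^sub>R r + \<tau> r) \<bullet> (a *\<^sub>R r + \<tau> r) = (a\<^sup>2 + a + 1) * (r \<bullet> r)"
    by (simp only: inner_add inner_scaleR_left inner_scaleR_right)
      (simp add: algebra_simps power2_eq_square)
  then show ?thesis by (simp add: power2_norm_eq_inner)
qed

text \<open>The Voronoi cell of 0: the half-space conditions say that 0 is a nearest lattice point.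
  The norm bound comes from \<open>covering\<close> and limits the diameter to 2.\<close>

definition cell :: "'a set" where
  "cell = {u. norm u \<le> 1 \<and> (\<forall>v\<in>L. u \<bullet> v \<le> (norm v)\<^sup>2 / 2)}"

lemma cell_cover: "\<exists>l\<in>L. p - l \<in> cell"
proof -
  have "norm x \<ge> 1" if "x \<in> L" "x \<noteq> 0" for x
  proof (rule power2_le_imp_le)
    show "1\<^sup>2 \<le> (norm x)\<^sup>2" using norms[OF that] by auto
  qed simp
  moreover have "L \<noteq> {}" using zero_mem by blast
  ultimately obtain l where l: "l \<in> L" "\<And>v. v \<in> L \<Longrightarrow> dist p l \<le> dist p v"
    "\<And>v. v \<in> L \<Longrightarrow> (p - l) \<bullet> v \<le> (norm v)\<^sup>2 / 2"
    using nearest_lattice_point[of L 1 p] diff zero_less_one by blast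
  moreover have "norm (p - l) \<le> 1"
    using covering[of p] l(2) by (metis dist_norm order_trans)
  ultimately show ?thesis unfolding cell_def by blast
qed

text \<open>If \<open>r\<close> is a minimal vector, then the functional \<open>(4 + \<tau>) r\<close> separates \<open>(2 + \<tau>) r\<close> from the
  doubled cell: it takes the value 24 at the former and is at most 10 on the latter.\<close>

lemma cell_separation:
  assumes r: "r \<in> L" "r \<noteq> 0" and u: "u \<in> cell" and v: "v \<in> cell"
  shows "(norm (2 *\<^sub>R r + \<tau> r + (u - v)))\<^sup>2 \<ge> 14 / 3"
proof -
  let ?x = "2 *\<^sub>R r + \<tau> r"
  have uv: "norm (u - v) \<le> 2"
    using u v norm_triangle_ineq4[of u v] unfolding cell_def by auto
  have sep: "(u - v) \<bullet> z \<ge> - (norm z)\<^sup>2" if "z \<in> L" for z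
  proof -
    have "v \<bullet> z \<le> (norm z)\<^sup>2 / 2" "u \<bullet> (- z) \<le> (norm (- z))\<^sup>2 / 2"
      using u v that uminus_mem unfolding cell_def by blast+
    then show ?thesis by (simp add: inner_diff_left)
  qed
  consider "(norm r)\<^sup>2 = 2" | "(norm r)\<^sup>2 \<ge> 3" using norms r by blast
  then show ?thesis
  proof cases
    case 1
    \<comment> \<open>A functional \<open>a r + b \<tau> r\<close> with nonnegative
      \<open>a\<close>, \<open>b\<close> yields the bound (3 a + 2 b)^2 / (2 (a^2 + a b + b^2)),
      which is largest for a : b = 4 : 1, with value 14/3.\<close>
    let ?y = "4 *\<^sub>R r + \<tau> r"
    have y: "(norm ?y)\<^sup>2 = 42" using norm_comb[of 4 r] 1 by simp
    have "\<tau> r \<bullet> \<tau> r = 2" "r \<bullet> r = 2" "\<tau> r \<bullet> r = 1" "r \<bullet> \<tau> r = 1"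
      using tau_norm[of r] tau_inner[of r] 1 by (simp_all add: inner_commute flip: power2_norm_eq_inner)
    then have "?x \<bullet> ?y = 24"
      by (simp add: inner_add)
    moreover have "(u - v) \<bullet> ?y \<ge> - 10"
      using sep[OF r(1)] sep[OF tau_mem[OF r(1)]] 1 by (simp add: tau_norm inner_add_right)
    ultimately have "14 \<le> (?x + (u - v)) \<bullet> ?y"
      by (simp add: inner_add_left)
    also have "\<dots> \<le> norm (?x + (u - v)) * norm ?y"
      by (rule norm_cauchy_schwarz)
    finally have "14\<^sup>2 \<le> (norm (?x + (u - v)) * norm ?y)\<^sup>2"
      by (rule power_mono) simp
    then show ?thesis by (simp add: power_mult_distrib y)
  next
    case 2
    have "(norm ?x)\<^sup>2 \<ge> 21" using norm_comb[of 2 r] 2 by simp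
    then have "(9/2)\<^sup>2 \<le> (norm ?x)\<^sup>2" by (simp add: power2_eq_square)
    then have "9/2 \<le> norm ?x" by (rule power2_le_imp_le) simp
    then have "5/2 \<le> norm (?x + (u - v))"
      using uv norm_diff_ineq[of ?x "u - v"] by linarith
    then have "(5/2)\<^sup>2 \<le> (norm (?x + (u - v)))\<^sup>2"
      by (rule power_mono) simp
    then show ?thesis by (simp add: power2_eq_square)
  qed
qed

text \<open>The space \<open>'a \<times> \<real>\<close> is cut into layers of thickness \<open>h\<close>, and four consecutive layers use disjoint
  palettes. With \<open>h\<^sup>2 = 3/5\<close> the diameter of a cell of a layer is at most \<open>D\<close> where \<open>D\<^sup>2 = 4 + h\<^sup>2\<close>, and
  both \<open>D\<^sup>2 < 14/3\<close> and \<open>D\<^sup>2 < (3 h)\<^sup>2\<close>.\<close>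

theorem colorable_Times_real:
  assumes dim: "DIM('b::euclidean_space) = DIM('a) + 1"
  shows "unit_dist_colorable (UNIV :: 'b set) (4 * K)"
proof -
  obtain l where l: "\<And>p. l p \<in> L" "\<And>p. p - l p \<in> cell"
    using cell_cover by metis
  define h :: real where "h = sqrt (3/5)"
  have h: "h > 0" "h\<^sup>2 = 3/5" by (auto simp: h_def)
  define D :: real where "D = sqrt (23/5)"
  have D: "D > 0" "D\<^sup>2 = 23/5" by (auto simp: D_def)
  define j where "j s = \<lfloor>s / h\<rfloor>" for s :: real
  define c :: "'a \<times> real \<Rightarrow> nat" where "c = (\<lambda>(p, s). \<kappa> (l p) + K * nat (j s mod 4))"
  have c_less: "c x < 4 * K" for x
  proof -
    obtain p s where x: "x = (p, s)" by (cases x)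
    have "nat (j s mod 4) \<le> 3" by (simp add: nat_le_iff)
    then have "K * nat (j s mod 4) \<le> K * 3" by (rule mult_le_mono2)
    then show ?thesis using color_less[of "l p"] unfolding x c_def prod.case by linarith
  qed
  have c_neq: "c x \<noteq> c y" if xy: "dist x y = D" for x y
  proof
    assume eq: "c x = c y"
    obtain p s where x: "x = (p, s)" by (cases x)
    obtain q t where y: "y = (q, t)" by (cases y)
    have K: "K > 0" using color_less by (metis not_less_zero gr0I)
    have mod: "c (p', s') mod K = \<kappa> (l p')" "c (p', s') div K = nat (j s' mod 4)" for p' s'
      using color_less[of "l p'"] K by (simp_all add: c_def)
    have "nat (j s mod 4) = nat (j t mod 4)"
      using eq mod(2) unfolding x y by metis
    then have layer: "j s mod 4 = j t mod 4"
      by (simp add: eq_nat_nat_iff)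
    have "\<kappa> (l p) = \<kappa> (l q)" using eq mod(1) unfolding x y by metis
    then obtain r where r: "r \<in> L" "l p - l q = 2 *\<^sub>R r + \<tau> r"
      using color_eq l by blast
    have dist: "(norm (p - q))\<^sup>2 + (s - t)\<^sup>2 = 23/5"
    proof -
      have "(dist x y)\<^sup>2 = (norm (p - q))\<^sup>2 + (s - t)\<^sup>2"
        by (simp add: x y dist_norm norm_Pair)
      then show ?thesis using xy D(2) by simp
    qed
    have j: "j a * h \<le> a" "a < j a * h + h" for a
      using floor_divide_lower[OF h(1), of a] floor_divide_upper[OF h(1), of a]
      unfolding j_def by (simp_all add: distrib_right)
    show False
    proof (cases "j s = j t")
      case True
      \<comment> \<open>The half-open layers make this strict, which matters: the bound 2 for points
        of one cell is not strict, and 4 + h^2 is exactly D^2.\<close>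
      have "\<bar>s - t\<bar> < h" using j[of s] j[of t] True by auto
      then have "\<bar>s - t\<bar>\<^sup>2 < h\<^sup>2" by (rule power_strict_mono) auto
      then have st: "(s - t)\<^sup>2 < 3/5" by (simp add: h(2))
      have pq: "p - q = 2 *\<^sub>R r + \<tau> r + ((p - l p) - (q - l q))" using r(2) by (simp add: algebra_simps)
      show False
      proof (cases "r = 0")
        case True
        then have "p - q = (p - l p) - (q - l q)" using pq tau_norm[of r] by simp
        then have "norm (p - q) \<le> 2"
          using l(2)[of p] l(2)[of q] norm_triangle_ineq4[of "p - l p" "q - l q"]
          unfolding cell_def by auto
        then have "(norm (p - q))\<^sup>2 \<le> 2\<^sup>2" by (rule power_mono) simp
        then show False using dist st by simp
      next
        case False
        then have "(norm (p - q))\<^sup>2 \<ge> 14/3"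
          using cell_separation[OF r(1) _ l(2) l(2)] pq by metis
        then show False using dist zero_le_power2[of "s - t"] by linarith
      qed
    next
      case False
      \<comment> \<open>Distinct layers with the same palette have at least three whole layers
        between them.\<close>
      then have "\<bar>j s - j t\<bar> \<ge> 4" using layer by presburger
      then have "4 \<le> \<bar>real_of_int (j s) - real_of_int (j t)\<bar>" by linarith
      then have "real_of_int (j s) \<ge> j t + 4 \<or> real_of_int (j t) \<ge> j s + 4" by linarith
      then have "(real_of_int (j t) + 4) * h \<le> j s * h \<or> (real_of_int (j s) + 4) * h \<le> j t * h"
        using h(1) by auto
      then have "3 * h \<le> \<bar>s - t\<bar>"
        using j[of s] j[of t] unfolding distrib_right by linarith
      then have "(3 * h)\<^sup>2 \<le> \<bar>s - t\<bar>\<^sup>2"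
        using h(1) by (intro power_mono) auto
      then have "27/5 \<le> (s - t)\<^sup>2" by (simp add: power_mult_distrib h(2))
      then show False using dist zero_le_power2[of "norm (p - q)"] by linarith
    qed
  qed
  show ?thesis
  proof (rule unit_dist_colorable_transfer[where S = UNIV and D = D and c = c])
    show "dim (UNIV :: ('a \<times> real) set) = DIM('b)" by (simp add: dim)
  qed (simp_all add: D(1) c_less c_neq)
qed

end

section \<open>The lattice \<open>E\<^sub>8\<close>\<close>

text \<open>Up to the names of the coordinates this is \<open>D\<^sub>8\<^sup>+\<close>. The two quadruples of coordinates are regarded as
  quaternions, and \<open>quat_mult\<close> is left multiplication by the unit \<open>(1 + i + j + k) / 2\<close> of order 6.\<close>

definition E8 :: "(real ^ (2 \<times> 4)) set" where
  "E8 = {x. \<exists>(Z :: 2 \<times> 4 \<Rightarrow> int) e. even (\<Sum>i\<in>UNIV. Z i) \<and> (\<forall>i. x $ i = of_int (Z i) + of_int e / 2)}"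

definition quat_mult :: "real ^ (2 \<times> 4) \<Rightarrow> real ^ (2 \<times> 4)" where
  "quat_mult x = (\<chi> p. let b = fst p in
     (if snd p = 1 then x $ (b, 1) - x $ (b, 2) - x $ (b, 3) - x $ (b, 4)
      else if snd p = 2 then x $ (b, 1) + x $ (b, 2) - x $ (b, 3) + x $ (b, 4)
      else if snd p = 3 then x $ (b, 1) + x $ (b, 2) + x $ (b, 3) - x $ (b, 4)
      else x $ (b, 1) - x $ (b, 2) + x $ (b, 3) + x $ (b, 4)) / 2)"

lemma quat_mult_nth [simp]:
  "quat_mult x $ (b, 1) = (x $ (b, 1) - x $ (b, 2) - x $ (b, 3) - x $ (b, 4)) / 2"
  "quat_mult x $ (b, 2) = (x $ (b, 1) + x $ (b, 2) - x $ (b, 3) + x $ (b, 4)) / 2"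
  "quat_mult x $ (b, 3) = (x $ (b, 1) + x $ (b, 2) + x $ (b, 3) - x $ (b, 4)) / 2"
  "quat_mult x $ (b, 4) = (x $ (b, 1) - x $ (b, 2) + x $ (b, 3) + x $ (b, 4)) / 2"
  by (simp_all add: quat_mult_def Let_def)

lemma sum_2_4: "sum f (UNIV :: (2 \<times> 4) set) =
    f (1, 1) + f (1, 2) + f (1, 3) + f (1, 4) + (f (2, 1) + f (2, 2) + f (2, 3) + f (2, 4))"
proof -
  have "sum f (UNIV :: (2 \<times> 4) set) = (\<Sum>b\<in>UNIV. \<Sum>i\<in>UNIV. f (b, i))"
    by (simp add: sum.cartesian_product)
  then show ?thesis by (simp add: sum_2 sum_4)
qed

lemma forall_2_4: "(\<forall>p :: 2 \<times> 4. P p) \<longleftrightarrow> (\<forall>b. P (b, 1) \<and> P (b, 2) \<and> P (b, 3) \<and> P (b, 4))"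
  by (metis exhaust_4 surj_pair)

lemma vec_eq_2_4: "x = y \<longleftrightarrow> (\<forall>b. x $ (b, 1) = y $ (b, 1) \<and> x $ (b, 2) = y $ (b, 2)
    \<and> x $ (b, 3) = y $ (b, 3) \<and> x $ (b, 4) = y $ (b, 4))" for x y :: "'a ^ (2 \<times> 4)"
  unfolding vec_eq_iff by (rule forall_2_4)

lemma E8_I: "even (\<Sum>i\<in>UNIV. Z i) \<Longrightarrow> (\<And>i. x $ i = of_int (Z i) + of_int e / 2) \<Longrightarrow> x \<in> E8"
  unfolding E8_def by blast

lemma E8_E:
  assumes "x \<in> E8"
  obtains Z e where "even (\<Sum>i\<in>UNIV. Z i)" "\<And>i. x $ i = of_int (Z i) + of_int e / 2"
  using assms unfolding E8_def by blast

lemma E8_diff: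
  assumes "x \<in> E8" "y \<in> E8"
  shows "x - y \<in> E8"
proof -
  obtain Z e where Z: "even (\<Sum>i\<in>UNIV. Z i)" "\<And>i. x $ i = of_int (Z i) + of_int e / 2"
    using E8_E[OF assms(1)] by blast
  obtain W d where W: "even (\<Sum>i\<in>UNIV. W i)" "\<And>i. y $ i = of_int (W i) + of_int d / 2"
    using E8_E[OF assms(2)] by blast
  show ?thesis
    by (rule E8_I[of "\<lambda>i. Z i - W i" _ "e - d"])
      (use Z W in \<open>auto simp: sum_subtractf diff_divide_distrib\<close>)
qed

text \<open>Up to integers, all new coordinates of block \<open>b\<close> equal half the block sum
  \<open>s b\<close> plus \<open>e / 2\<close>. The two block sums have equal parity because the
  total is even, so the common offset \<open>(s 1 + e) / 2\<close> fits both blocks.\<close>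

lemma E8_quat_mult:
  assumes "x \<in> E8"
  shows "quat_mult x \<in> E8"
proof -
  obtain Z e where Z: "even (\<Sum>i\<in>UNIV. Z i)" "\<And>i. x $ i = of_int (Z i) + of_int e / 2"
    using E8_E[OF assms] by blast
  define s where "s b = Z (b, 1) + Z (b, 2) + Z (b, 3) + Z (b, 4)" for b
  have "even (s 1 + s 2)" using Z(1) unfolding sum_2_4 s_def .
  then have "even (s 2 - s 1)" by simp
  then obtain t where t: "s 2 = s 1 + 2 * t" by (metis diff_eq_eq add.commute evenE)
  define T where "T b = (if b = 1 then 0 else t)" for b :: 2
  have T: "s b = s 1 + 2 * T b" for b
    using t exhaust_2[of b] unfolding T_def by auto
  define W where "W p = T (fst p) - (if snd p = 1 then Z (fst p, 2) + Z (fst p, 3) + Z (fst p, 4) + e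
      else if snd p = 2 then Z (fst p, 3) else if snd p = 3 then Z (fst p, 4) else Z (fst p, 2))"
    for p :: "2 \<times> 4"
  have W: "W (b, 1) = T b - (Z (b, 2) + Z (b, 3) + Z (b, 4) + e)"
    "W (b, 2) = T b - Z (b, 3)" "W (b, 3) = T b - Z (b, 4)" "W (b, 4) = T b - Z (b, 2)" for b
    unfolding W_def by simp_all
  show ?thesis
  proof (rule E8_I[of W _ "s 1 + e"])
    show "even (\<Sum>i\<in>UNIV. W i)"
    proof -
      have "(\<Sum>i\<in>UNIV. W i) = 2 * (2 * T 1 + 2 * T 2 - e
          - (Z (1, 2) + Z (1, 3) + Z (1, 4) + Z (2, 2) + Z (2, 3) + Z (2, 4)))"
        unfolding sum_2_4 W by simp
      then show ?thesis by (metis dvd_triv_left)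
    qed
    have sT: "real_of_int (Z (b, 1)) + Z (b, 2) + Z (b, 3) + Z (b, 4) = s 1 + 2 * real_of_int (T b)" for b
    proof -
      have "real_of_int (s b) = s 1 + 2 * real_of_int (T b)" by (subst T) simp
      then show ?thesis by (simp add: s_def[of b])
    qed
    show "quat_mult x $ i = real_of_int (W i) + real_of_int (s 1 + e) / 2" for i
    proof -
      have "\<forall>i. quat_mult x $ i = real_of_int (W i) + real_of_int (s 1 + e) / 2"
        unfolding forall_2_4
      proof (intro allI conjI)
        fix b
        show "quat_mult x $ (b, 1) = real_of_int (W (b, 1)) + real_of_int (s 1 + e) / 2"
          "quat_mult x $ (b, 2) = real_of_int (W (b, 2)) + real_of_int (s 1 + e) / 2"
          "quat_mult x $ (b, 3) = real_of_int (W (b, 3)) + real_of_int (s 1 + e) / 2"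
          "quat_mult x $ (b, 4) = real_of_int (W (b, 4)) + real_of_int (s 1 + e) / 2"
          using sT[of b] unfolding quat_mult_nth W Z(2) of_int_add of_int_diff by argo+
      qed
      then show ?thesis by blast
    qed
  qed
qed

text \<open>The lattice is even: the squared norm is the sum of \<open>(Z i)\<^sup>2\<close> plus
  \<open>e\<close> times the sum of \<open>Z i\<close> plus \<open>2 * e\<^sup>2\<close>, and the
  first sum has the parity of the sum of \<open>Z i\<close>.\<close>

lemma E8_norm:
  assumes "x \<in> E8" "x \<noteq> 0"
  shows "(norm x)\<^sup>2 = 2 \<or> (norm x)\<^sup>2 \<ge> 3"
proof -
  obtain Z e where Z: "even (\<Sum>i\<in>UNIV. Z i)" "\<And>i. x $ i = of_int (Z i) + of_int e / 2"
    using E8_E[OF assms(1)] by blast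
  have ev: "even ((\<Sum>i\<in>UNIV. (Z i)\<^sup>2) - (\<Sum>i\<in>UNIV. Z i))"
    unfolding sum_subtractf[symmetric] by (intro dvd_sum) (simp add: power2_eq_square)
  obtain k where k: "(\<Sum>i\<in>UNIV. (Z i)\<^sup>2) + e * (\<Sum>i\<in>UNIV. Z i) + 2 * e\<^sup>2 = 2 * k"
  proof -
    have "even ((\<Sum>i\<in>UNIV. (Z i)\<^sup>2) + e * (\<Sum>i\<in>UNIV. Z i) + 2 * e\<^sup>2)"
      using ev Z(1) by simp
    then show ?thesis using that by (elim evenE)
  qed
  have "(norm x)\<^sup>2 = (\<Sum>i\<in>UNIV. (of_int (Z i))\<^sup>2 + of_int e * of_int (Z i) + (of_int e)\<^sup>2 / 4)"
    unfolding norm_sq_vec Z(2) by (intro sum.cong) (auto simp: power2_eq_square field_simps)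
  also have "\<dots> = of_int ((\<Sum>i\<in>UNIV. (Z i)\<^sup>2) + e * (\<Sum>i\<in>UNIV. Z i) + 2 * e\<^sup>2)"
    by (simp add: sum.distrib sum_distrib_left)
  finally have n: "(norm x)\<^sup>2 = 2 * of_int k" using k by simp
  moreover have "(norm x)\<^sup>2 > 0" using assms(2) by simp
  ultimately have "k \<ge> 1" by simp
  then consider "k = 1" | "k \<ge> 2" by linarith
  then show ?thesis by cases (auto simp: n)
qed

lemma quat_mult_norm: "norm (quat_mult x) = norm x"
proof -
  have "(norm (quat_mult x))\<^sup>2 = (norm x)\<^sup>2"
    unfolding norm_sq_vec sum_2_4 quat_mult_nth by (simp add: power2_eq_square field_simps)
  then show ?thesis by simp
qed

lemma quat_mult_inner: "quat_mult x \<bullet> x = (norm x)\<^sup>2 / 2"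
  unfolding norm_sq_vec inner_vec_def sum_2_4 quat_mult_nth by (simp add: power2_eq_square field_simps)

text \<open>As 7 is odd, the parity condition survives the division, so divisibility can be tested
  on single coordinates. The factor 4 is prime to 7; it clears the halves in the coordinates and in
  \<open>quat_mult\<close>.\<close>

lemma E8_div_7:
  assumes "y \<in> E8" "\<And>i. \<exists>m. 4 * y $ i = 7 * of_int m"
  shows "(1/7) *\<^sub>R y \<in> E8"
proof -
  obtain Z e where Z: "even (\<Sum>i\<in>UNIV. Z i)" "\<And>i. y $ i = of_int (Z i) + of_int e / 2"
    using E8_E[OF assms(1)] by blast
  have "\<exists>u. Z i = 7 * u + 3 * e" for i
  proof -
    obtain m where "4 * y $ i = 7 * of_int m" using assms(2) by blast
    then have "real_of_int (4 * Z i + 2 * e) = of_int (7 * m)" unfolding Z(2) by simp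
    then have "4 * Z i + 2 * e = 7 * m" by (simp only: of_int_eq_iff)
    then show ?thesis by presburger
  qed
  then obtain u where u: "\<And>i. Z i = 7 * u i + 3 * e" by metis
  show ?thesis
  proof (rule E8_I[of u _ e])
    have "(\<Sum>i\<in>UNIV. Z i) = 7 * (\<Sum>i\<in>UNIV. u i) + 24 * e"
      by (simp add: u sum.distrib sum_distrib_left)
    then show "even (\<Sum>i\<in>UNIV. u i)" using Z(1) by presburger
    show "((1/7) *\<^sub>R y) $ i = of_int (u i) + of_int e / 2" for i
      by (simp add: Z(2) u field_simps)
  qed
qed

section \<open>Covering radius of \<open>E8\<close>\<close>

lemma E8_near:
  fixes p :: "real ^ (2 \<times> 4)" and Z :: "2 \<times> 4 \<Rightarrow> int" and e \<delta> :: int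
  assumes d: "\<And>i. d i = p $ i - of_int (Z i) - of_int e / 2"
    and \<delta>: "\<delta> = 1 \<or> \<delta> = -1" "of_int \<delta> * d j \<le> 1/2"
  shows "\<exists>l\<in>E8. (dist p l)\<^sup>2 \<le> (\<Sum>i\<in>UNIV. (d i)\<^sup>2) + 1 - 2 * (of_int \<delta> * d j)"
proof (cases "even (\<Sum>i\<in>UNIV. Z i)")
  case True
  define l :: "real ^ (2 \<times> 4)" where "l = (\<chi> i. of_int (Z i) + of_int e / 2)"
  have "l \<in> E8" by (rule E8_I[OF True, of _ e]) (simp add: l_def)
  moreover have "(dist p l)\<^sup>2 = (\<Sum>i\<in>UNIV. (d i)\<^sup>2)"
    by (simp add: dist_norm norm_sq_vec l_def d diff_diff_eq)
  ultimately show ?thesis using \<delta>(2) by (intro bexI[of _ l]) auto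
next
  case False
  \<comment> \<open>A unit step in coordinate \<open>j\<close> repairs the parity and changes the
    squared distance by \<open>1 - 2 * (\<delta> * d j)\<close>. This is nonnegative by assumption,
    so one bound covers both cases.\<close>
  define W where "W i = Z i + (if i = j then \<delta> else 0)" for i
  define l :: "real ^ (2 \<times> 4)" where "l = (\<chi> i. of_int (W i) + of_int e / 2)"
  have "(\<Sum>i\<in>UNIV. W i) = (\<Sum>i\<in>UNIV. Z i) + \<delta>"
    unfolding W_def by (simp add: sum.distrib)
  then have "even (\<Sum>i\<in>UNIV. W i)" using False \<delta>(1) by auto
  then have "l \<in> E8" by (rule E8_I[of _ _ e]) (simp add: l_def)
  moreover have "(dist p l)\<^sup>2 = (\<Sum>i\<in>UNIV. (d i)\<^sup>2 + (if i = j then 1 - 2 * (of_int \<delta> * d j) else 0))"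
    unfolding dist_norm norm_sq_vec
    by (intro sum.cong refl) (use \<delta>(1) in \<open>auto simp: l_def W_def d power2_eq_square field_simps\<close>)
  then have "(dist p l)\<^sup>2 = (\<Sum>i\<in>UNIV. (d i)\<^sup>2) + 1 - 2 * (of_int \<delta> * d j)"
    by (simp add: sum.distrib)
  ultimately show ?thesis by (intro bexI[of _ l]) auto
qed

text \<open>Here \<open>f\<close> lists the distances to the nearest integers. The alternatives
  bound the squared distances to an integral and to a half-integral lattice point, the parity being
  repaired where this is cheapest: at the largest \<open>f i\<close> in the former case, at the
  smallest in the latter.\<close>

lemma E8_covering_ineq:
  fixes f :: "2 \<times> 4 \<Rightarrow> real"
  assumes m: "\<And>i. m \<le> f i" "0 \<le> m" and F: "\<And>i. f i \<le> F" "F \<le> 1/2"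
  shows "(\<Sum>i\<in>UNIV. (f i)\<^sup>2) + 1 - 2 * F \<le> 1 \<or> (\<Sum>i\<in>UNIV. (1/2 - f i)\<^sup>2) + 2 * m \<le> 1"
proof (rule ccontr)
  define S where "S = (\<Sum>i\<in>UNIV. f i)"
  define Q where "Q = (\<Sum>i\<in>UNIV. (f i)\<^sup>2)"
  assume "\<not> ?thesis"
  moreover have "(\<Sum>i\<in>UNIV. (1/2 - f i)\<^sup>2) = 2 - S + Q"
    unfolding S_def Q_def sum_2_4 by (simp add: power2_eq_square algebra_simps)
  ultimately have Q1: "2 * F < Q" and Q2: "S - Q < 1 + 2 * m"
    unfolding Q_def by auto
  have "0 \<le> (\<Sum>i\<in>UNIV. (f i - m) * (F - f i))"
    using m(1) F(1) by (intro sum_nonneg mult_nonneg_nonneg) auto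
  also have "\<dots> = (m + F) * S - Q - 8 * (m * F)"
    unfolding S_def Q_def sum_2_4 by (simp add: power2_eq_square algebra_simps)
  finally have Q3: "Q \<le> (m + F) * S - 8 * (m * F)" by simp
  have mF: "m \<le> F" using m(1) F(1) order_trans by blast
  have a: "2 * F + 8 * (m * F) < (m + F) * S" using Q1 Q3 by linarith
  have b: "S * (1 - (m + F)) < 1 + 2 * m - 8 * (m * F)"
    using Q2 Q3 by (simp add: algebra_simps)
  have pos: "m + F > 0"
  proof (rule ccontr)
    assume "\<not> 0 < m + F"
    then have "m = 0" "F = 0" using m(2) mF by linarith+
    then show False using a by simp
  qed
  \<comment> \<open>Eliminates \<open>S\<close> between \<open>a\<close> and \<open>b\<close>; what
    is left depends only on \<open>F - m\<close>, which lies between 0 and 1/2.\<close>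
  have "(2 * F + 8 * (m * F)) * (1 - (m + F)) \<le> ((m + F) * S) * (1 - (m + F))"
    using a m F mF by (intro mult_right_mono) auto
  also have "\<dots> = (m + F) * (S * (1 - (m + F)))" by simp
  also have "\<dots> < (m + F) * (1 + 2 * m - 8 * (m * F))"
    using b pos by (rule mult_strict_left_mono)
  finally have "(F - m) * (1 - 2 * (F - m)) < 0" by (simp add: algebra_simps)
  moreover have "0 \<le> (F - m) * (1 - 2 * (F - m))"
    using mF m(2) F(2) by (intro mult_nonneg_nonneg) auto
  ultimately show False by linarith
qed

lemma E8_covering: "\<exists>l\<in>E8. dist p l \<le> 1"
proof -
  define n where "n i = round (p $ i)" for i
  define g where "g i = p $ i - of_int (n i)" for i
  define s :: "2 \<times> 4 \<Rightarrow> int" where "s i = (if g i \<ge> 0 then 1 else -1)" for i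
  define f where "f i = \<bar>g i\<bar>" for i
  have s: "s i = 1 \<or> s i = -1" "of_int (s i) * g i = f i" "of_int (s i) * f i = g i" for i
    unfolding s_def f_def by auto
  have f: "0 \<le> f i" "f i \<le> 1/2" for i
    using of_int_round_abs_le[of "p $ i"] unfolding f_def g_def n_def by (auto simp: abs_minus_commute)
  have "Max (range f) \<in> range f" by (rule Max_in) auto
  then obtain j where "Max (range f) = f j" by blast
  then have j: "f i \<le> f j" for i by (metis Max_ge finite finite_imageI rangeI)
  have "Min (range f) \<in> range f" by (rule Min_in) auto
  then obtain k where "Min (range f) = f k" by blast
  then have k: "f k \<le> f i" for i by (metis Min_le finite finite_imageI rangeI)
  have "\<exists>l\<in>E8. (dist p l)\<^sup>2 \<le> (\<Sum>i\<in>UNIV. (g i)\<^sup>2) + 1 - 2 * (of_int (s j) * g j)"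
    by (rule E8_near[of _ _ n 0]) (use s f(2) in \<open>auto simp: g_def\<close>)
  then obtain l where l: "l \<in> E8" "(dist p l)\<^sup>2 \<le> (\<Sum>i\<in>UNIV. (f i)\<^sup>2) + 1 - 2 * f j"
    unfolding s(2) f_def by auto
  \<comment> \<open>The displacement from the nearest half-integer
    \<open>n i + s i / 2\<close>.\<close>
  let ?d = "\<lambda>i. of_int (s i) * (f i - 1/2)"
  have sk: "of_int (- s k) * ?d k = 1/2 - f k"
    using s(1)[of k] by auto
  have "\<exists>l\<in>E8. (dist p l)\<^sup>2 \<le> (\<Sum>i\<in>UNIV. (?d i)\<^sup>2) + 1 - 2 * (of_int (- s k) * ?d k)"
  proof (rule E8_near[of _ _ "\<lambda>i. n i + (s i - 1) div 2" 1])
    show "?d i = p $ i - of_int (n i + (s i - 1) div 2) - of_int 1 / 2" for i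
    proof -
      have "?d i = g i - of_int (s i) / 2" using s(3)[of i] by (simp add: algebra_simps)
      then show ?thesis using s(1)[of i] unfolding g_def by auto
    qed
    show "- s k = 1 \<or> - s k = - 1" using s(1)[of k] by auto
    show "of_int (- s k) * ?d k \<le> 1/2" unfolding sk using f(1) by simp
  qed
  moreover have "(?d i)\<^sup>2 = (1/2 - f i)\<^sup>2" for i
    using s(1)[of i] by (auto simp: power2_commute)
  ultimately obtain l' where l': "l' \<in> E8" "(dist p l')\<^sup>2 \<le> (\<Sum>i\<in>UNIV. (1/2 - f i)\<^sup>2) + 2 * f k"
    unfolding sk by auto
  have "(dist p l)\<^sup>2 \<le> 1 \<or> (dist p l')\<^sup>2 \<le> 1"
    using E8_covering_ineq[of "f k" f "f j", OF k f(1) j f(2)] l(2) l'(2) by linarith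
  then show ?thesis using l(1) l'(1) by (auto simp: abs_square_le_1)
qed

text \<open>As \<open>(2 + \<tau>) (3 - \<tau>) = 7\<close>, a vector \<open>x\<close> lies in \<open>(2 + \<tau>) E8\<close> iff \<open>(3 - \<tau>) x\<close> is divisible by 7. For each
  of the two quaternions this is a system of rank 2 modulo 7, solved here for the last two coordinates.\<close>

definition E8_color :: "real ^ (2 \<times> 4) \<Rightarrow> nat" where
  "E8_color x = (let X = (\<lambda>b i. \<lfloor>2 * x $ (b, i)\<rfloor>);
       d = (\<lambda>b. (X b 3 - 5 * X b 1 - 4 * X b 2) mod 7);
       d' = (\<lambda>b. (X b 4 - 4 * X b 1 - 2 * X b 2) mod 7)
     in nat (d 1 + 7 * (d' 1 + 7 * (d 2 + 7 * d' 2))))"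

lemma E8_color_eq:
  assumes x: "x \<in> E8" and y: "y \<in> E8" and eq: "E8_color x = E8_color y"
  shows "\<exists>r\<in>E8. x - y = 2 *\<^sub>R r + quat_mult r"
proof -
  define X where "X b i = \<lfloor>2 * x $ (b, i)\<rfloor>" for b i
  define Y where "Y b i = \<lfloor>2 * y $ (b, i)\<rfloor>" for b i
  define D where "D b i = X b i - Y b i" for b i
  define z where "z = x - y"
  have z: "z \<in> E8" unfolding z_def using x y by (rule E8_diff)
  have int: "\<exists>k::int. 2 * w $ i = of_int k" if w: "w \<in> E8" for w i
  proof -
    obtain Z e where "\<And>i. w $ i = of_int (Z i) + of_int e / 2" using E8_E[OF w] by blast
    then have "2 * w $ i = of_int (2 * Z i + e)" by simp
    then show ?thesis by blast
  qed
  have D: "2 * z $ (b, i) = of_int (D b i)" for b i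
    using int[OF x, of "(b, i)"] int[OF y, of "(b, i)"] unfolding D_def X_def Y_def z_def by auto
  define d where "d X b = (X b (3::4) - 5 * X b 1 - 4 * X b 2) mod 7" for X :: "2 \<Rightarrow> 4 \<Rightarrow> int" and b
  define d' where "d' X b = (X b (4::4) - 4 * X b 1 - 2 * X b 2) mod 7" for X :: "2 \<Rightarrow> 4 \<Rightarrow> int" and b
  have bd: "0 \<le> d X b" "d X b < 7" "0 \<le> d' X b" "d' X b < 7" for X b
    unfolding d_def d'_def by simp_all
  have nonneg: "0 \<le> d X 1 + 7 * (d' X 1 + 7 * (d X 2 + 7 * d' X 2))" for X
    by (intro add_nonneg_nonneg mult_nonneg_nonneg bd) simp_all
  have "nat (d X 1 + 7 * (d' X 1 + 7 * (d X 2 + 7 * d' X 2)))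
      = nat (d Y 1 + 7 * (d' Y 1 + 7 * (d Y 2 + 7 * d' Y 2)))"
    using eq unfolding E8_color_def Let_def X_def Y_def d_def d'_def .
  note * = eq_nat_nat_iff[OF nonneg nonneg, THEN iffD1, OF this]
  note 1 = base_digit[OF bd(1,2) bd(1,2) *]
  note 2 = base_digit[OF bd(3,4) bd(3,4) 1(2)]
  note 3 = base_digit[OF bd(1,2) bd(1,2) 2(2)]
  have dd: "d X b = d Y b" "d' X b = d' Y b" for b
    using 1(1) 2(1) 3 exhaust_2[of b] by (metis, metis)
  have D3: "\<exists>u. D b 3 = 5 * D b 1 + 4 * D b 2 + 7 * u" for b
  proof -
    have "7 dvd (X b 3 - 5 * X b 1 - 4 * X b 2) - (Y b 3 - 5 * Y b 1 - 4 * Y b 2)"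
      using dd(1)[of b] unfolding d_def by (simp only: mod_eq_dvd_iff)
    then obtain u where "(X b 3 - 5 * X b 1 - 4 * X b 2) - (Y b 3 - 5 * Y b 1 - 4 * Y b 2) = 7 * u"
      by (elim dvdE)
    then show ?thesis by (intro exI[of _ u]) (simp add: D_def)
  qed
  have D4: "\<exists>u. D b 4 = 4 * D b 1 + 2 * D b 2 + 7 * u" for b
  proof -
    have "7 dvd (X b 4 - 4 * X b 1 - 2 * X b 2) - (Y b 4 - 4 * Y b 1 - 2 * Y b 2)"
      using dd(2)[of b] unfolding d'_def by (simp only: mod_eq_dvd_iff)
    then obtain u where "(X b 4 - 4 * X b 1 - 2 * X b 2) - (Y b 4 - 4 * Y b 1 - 2 * Y b 2) = 7 * u"
      by (elim dvdE)
    then show ?thesis by (intro exI[of _ u]) (simp add: D_def)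
  qed
  define w where "w = 3 *\<^sub>R z - quat_mult z"
  \<comment> \<open>The tripling is again expressed by differences, so that \<open>E8_diff\<close>
    applies.\<close>
  have "w = (z - ((0 - z) - z)) - quat_mult z" unfolding w_def vec_eq_iff by simp
  moreover have "0 \<in> E8" using E8_diff[OF z z] by simp
  ultimately have w: "w \<in> E8" by (metis z E8_diff E8_quat_mult)
  have "\<exists>m. 4 * w $ i = 7 * of_int m" for i
  proof -
    have "\<forall>i. \<exists>m. 4 * w $ i = 7 * of_int m"
      unfolding forall_2_4
    proof (intro allI)
      fix b
      obtain u where u: "D b 3 = 5 * D b 1 + 4 * D b 2 + 7 * u" using D3 by blast
      obtain v where v: "D b 4 = 4 * D b 1 + 2 * D b 2 + 7 * v" using D4 by blast
      have x12: "z $ (b, 1) = D b 1 / 2" "z $ (b, 2) = D b 2 / 2"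
        "z $ (b, 3) = (5 * D b 1 + 4 * D b 2 + 7 * u) / 2" "z $ (b, 4) = (4 * D b 1 + 2 * D b 2 + 7 * v) / 2"
        using D[of b 1] D[of b 2] D[of b 3] D[of b 4] unfolding u v by simp_all
      have "4 * w $ (b, 1) = 7 * of_int (2 * D b 1 + D b 2 + u + v)"
        "4 * w $ (b, 2) = 7 * of_int (D b 2 + u - v)"
        "4 * w $ (b, 3) = 7 * of_int (4 * D b 1 + 3 * D b 2 + 5 * u + v)"
        "4 * w $ (b, 4) = 7 * of_int (2 * D b 1 + D b 2 - u + 5 * v)"
        unfolding w_def by (simp_all add: x12 field_simps)
      then show "(\<exists>m. 4 * w $ (b, 1) = 7 * real_of_int m) \<and> (\<exists>m. 4 * w $ (b, 2) = 7 * real_of_int m) \<and>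
          (\<exists>m. 4 * w $ (b, 3) = 7 * real_of_int m) \<and> (\<exists>m. 4 * w $ (b, 4) = 7 * real_of_int m)"
        by blast
    qed
    then show ?thesis by blast
  qed
  then have r: "(1/7) *\<^sub>R w \<in> E8" using w by (intro E8_div_7)
  have "z = 2 *\<^sub>R ((1/7) *\<^sub>R w) + quat_mult ((1/7) *\<^sub>R w)"
    unfolding vec_eq_2_4 w_def by (simp add: field_simps)
  then show ?thesis using r unfolding z_def by blast
qed

lemma E8_color_less: "E8_color x < 2401"
  unfolding E8_color_def Let_def by (simp add: nat_less_iff)

interpretation E8: eisenstein_lattice E8 quat_mult E8_color 2401
  by unfold_locales
    (fact E8_diff E8_quat_mult quat_mult_norm quat_mult_inner E8_norm E8_covering E8_color_less E8_color_eq)+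

section \<open>The dual of \<open>E\<^sub>6\<close>\<close>

definition omega6 :: complex where
  "omega6 = Complex (1/2) (sqrt 3 / 2)"

definition eis :: "int \<Rightarrow> int \<Rightarrow> complex" where
  "eis m n = of_int m + of_int n * omega6"

lemma eis_Re_Im: "Re (eis m n) = m + n / 2" "Im (eis m n) = n * sqrt 3 / 2"
  by (simp_all add: eis_def omega6_def)

lemma norm_eis_shift:
  "(cmod (of_real s + of_real t * omega6 - eis m n))\<^sup>2
    = (s - m)\<^sup>2 + (s - m) * (t - n) + (t - n)\<^sup>2"
proof -
  let ?z = "of_real s + of_real t * omega6 - eis m n"
  have "Re ?z = s - m + (t - n) / 2" "Im ?z = (t - n) / 2 * sqrt 3"
    by (simp_all add: eis_Re_Im omega6_def field_simps)
  then have "(cmod ?z)\<^sup>2 = (s - m + (t - n) / 2)\<^sup>2 + ((t - n) / 2)\<^sup>2 * 3"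
    unfolding cmod_power2 by (simp only: power_mult_distrib) simp
  then show ?thesis by (simp only:) (simp add: power2_eq_square field_simps)
qed

lemma norm_eis: "(cmod (eis m n))\<^sup>2 = of_int (m\<^sup>2 + m * n + n\<^sup>2)"
  using norm_eis_shift[of 0 0 m n] by (simp add: norm_minus_commute)

lemma omega6_sq: "omega6 * omega6 = omega6 - 1"
  by (simp add: omega6_def complex_eq_iff)

lemma omega6_mult_eis: "omega6 * eis m n = eis (- n) (m + n)"
proof -
  have "omega6 * eis m n = of_int m * omega6 + of_int n * (omega6 * omega6)"
    by (simp add: eis_def algebra_simps)
  then show ?thesis unfolding omega6_sq by (simp add: eis_def algebra_simps)
qed

text \<open>Since \<open>omega6\<close> is congruent to -1 modulo sqrt (-3), \<open>eis m n\<close>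
  is congruent to \<open>m - n\<close>. The condition thus says that sqrt (-3) divides the sum of
  the coordinates.\<close>

definition E6_dual :: "(complex ^ 3) set" where
  "E6_dual = {x. \<exists>m n :: 3 \<Rightarrow> int. 3 dvd (\<Sum>i\<in>UNIV. m i - n i) \<and> (\<forall>i. x $ i = eis (m i) (n i))}"

lemma E6_dual_I: "3 dvd (\<Sum>i\<in>UNIV. m i - n i) \<Longrightarrow> (\<And>i. x $ i = eis (m i) (n i)) \<Longrightarrow> x \<in> E6_dual"
  unfolding E6_dual_def by blast

lemma E6_dual_E:
  assumes "x \<in> E6_dual"
  obtains m n where "3 dvd (\<Sum>i\<in>UNIV. m i - n i)" "\<And>i. x $ i = eis (m i) (n i)"
  using assms unfolding E6_dual_def by blast

lemma E6_dual_diff: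
  assumes "x \<in> E6_dual" "y \<in> E6_dual"
  shows "x - y \<in> E6_dual"
proof -
  obtain m n where x: "3 dvd (\<Sum>i\<in>UNIV. m i - n i)" "\<And>i. x $ i = eis (m i) (n i)"
    using E6_dual_E[OF assms(1)] by blast
  obtain m' n' where y: "3 dvd (\<Sum>i\<in>UNIV. m' i - n' i)" "\<And>i. y $ i = eis (m' i) (n' i)"
    using E6_dual_E[OF assms(2)] by blast
  show ?thesis
  proof (rule E6_dual_I[of "\<lambda>i. m i - m' i" "\<lambda>i. n i - n' i"])
    have "(\<Sum>i\<in>UNIV. m i - m' i - (n i - n' i)) = (\<Sum>i\<in>UNIV. m i - n i) - (\<Sum>i\<in>UNIV. m' i - n' i)"
      unfolding sum_subtractf by simp
    then show "3 dvd (\<Sum>i\<in>UNIV. m i - m' i - (n i - n' i))"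
      by (simp only:) (intro dvd_diff x(1) y(1))
    show "(x - y) $ i = eis (m i - m' i) (n i - n' i)" for i
      by (simp add: x y eis_def algebra_simps)
  qed
qed

definition omega6_mult :: "complex ^ 3 \<Rightarrow> complex ^ 3" where
  "omega6_mult x = (\<chi> i. omega6 * x $ i)"

lemma E6_dual_omega6_mult:
  assumes "x \<in> E6_dual"
  shows "omega6_mult x \<in> E6_dual"
proof -
  obtain m n where x: "3 dvd (\<Sum>i\<in>UNIV. m i - n i)" "\<And>i. x $ i = eis (m i) (n i)"
    using E6_dual_E[OF assms] by blast
  show ?thesis
  proof (rule E6_dual_I[of "\<lambda>i. - n i" "\<lambda>i. m i + n i"])
    have "(\<Sum>i\<in>UNIV. - n i - (m i + n i)) = 0 - (\<Sum>i\<in>UNIV. m i - n i) - 3 * (\<Sum>i\<in>UNIV. n i)"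
      unfolding sum_3 by simp
    then show "3 dvd (\<Sum>i\<in>UNIV. - n i - (m i + n i))"
      by (simp only:) (intro dvd_diff x(1) dvd_0_right dvd_triv_left)
    show "omega6_mult x $ i = eis (- n i) (m i + n i)" for i
      by (simp add: x omega6_mult_def omega6_mult_eis)
  qed
qed

lemma norm_sq_complex_vec: "(norm x)\<^sup>2 = (\<Sum>i\<in>UNIV. (cmod (x $ i))\<^sup>2)" for x :: "complex ^ 'n"
  unfolding power2_norm_eq_inner inner_vec_def ..

lemma omega6_mult_norm: "norm (omega6_mult x) = norm x"
proof -
  have "(cmod omega6)\<^sup>2 = 1" unfolding cmod_power2 by (simp add: omega6_def power_divide)
  then have "(norm (omega6_mult x))\<^sup>2 = (norm x)\<^sup>2"
    unfolding norm_sq_complex_vec by (simp add: omega6_mult_def norm_mult power_mult_distrib)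
  then show ?thesis by simp
qed

lemma omega6_mult_inner: "omega6_mult x \<bullet> x = (norm x)\<^sup>2 / 2"
proof -
  have *: "(omega6 * z) \<bullet> z = (cmod z)\<^sup>2 / 2" for z
    unfolding cmod_power2 inner_complex_def omega6_def by (simp add: power2_eq_square algebra_simps)
  show ?thesis
    unfolding norm_sq_complex_vec inner_vec_def sum_divide_distrib omega6_mult_def
    by (simp only: vec_lambda_beta *)
qed

text \<open>The squared norm is an integer, and 1 is excluded modulo 3: with
  \<open>d i = m i - n i\<close> summing to 0 modulo 3, it is congruent to
  \<open>2 * (d 1 - d 2)\<^sup>2\<close>, hence to 0 or 2.\<close>

lemma E6_dual_norm:
  assumes "x \<in> E6_dual" "x \<noteq> 0"
  shows "(norm x)\<^sup>2 = 2 \<or> (norm x)\<^sup>2 \<ge> 3"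
proof -
  obtain m n where x: "3 dvd (\<Sum>i\<in>UNIV. m i - n i)" "\<And>i. x $ i = eis (m i) (n i)"
    using E6_dual_E[OF assms(1)] by blast
  define N where "N = (\<Sum>i\<in>UNIV. (m i)\<^sup>2 + m i * n i + (n i)\<^sup>2)"
  have norm: "(norm x)\<^sup>2 = of_int N"
    unfolding norm_sq_complex_vec x(2) norm_eis N_def by simp
  then have "N > 0" using assms(2) by (metis of_int_0_less_iff zero_less_norm_iff zero_less_power)
  moreover have "N \<noteq> 1"
  proof
    assume "N = 1"
    define d where "d i = m i - n i" for i
    obtain w where "(\<Sum>i\<in>UNIV. m i - n i) = 3 * w" using x(1) by (elim dvdE)
    then have w: "d 3 = 3 * w - d 1 - d 2" unfolding sum_3 d_def by simp
    have "N = (d 1)\<^sup>2 + (d 2)\<^sup>2 + (d 3)\<^sup>2 + 3 * (m 1 * n 1 + m 2 * n 2 + m 3 * n 3)"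
      unfolding N_def sum_3 d_def by (simp add: power2_eq_square algebra_simps)
    also have "\<dots> = 2 * (d 1 - d 2)\<^sup>2
        + 3 * (m 1 * n 1 + m 2 * n 2 + m 3 * n 3 + 3 * w\<^sup>2 - 2 * w * d 1 - 2 * w * d 2 + 2 * d 1 * d 2)"
      unfolding w by (simp add: power2_eq_square algebra_simps)
    finally obtain k where "1 = 2 * (d 1 - d 2)\<^sup>2 + 3 * k"
      unfolding \<open>N = 1\<close> by blast
    moreover have "X mod 3 = 2" if "1 = 2 * X + 3 * k" for X :: int using that by presburger
    ultimately have "(d 1 - d 2)\<^sup>2 mod 3 = 2" by blast
    moreover have "(d 1 - d 2) mod 3 \<in> {0, 1, 2}" by auto
    ultimately show False by (auto simp: power_mod[of "d 1 - d 2" 3 2, symmetric])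
  qed
  ultimately have "N = 2 \<or> N \<ge> 3" by linarith
  then show ?thesis unfolding norm by auto
qed

section \<open>Covering radius of the dual of \<open>E6\<close>\<close>

lemma triangle_vertex_dist:
  fixes l l1 l2 :: real
  assumes "l + l1 + l2 = 1"
  shows "l1\<^sup>2 + l1 * l2 + l2\<^sup>2 = 1 - l - (l * l1 + l1 * l2 + l * l2)"
proof -
  have l: "l = 1 - l1 - l2" using assms by simp
  show ?thesis unfolding l by (simp add: power2_eq_square algebra_simps)
qed

text \<open>In barycentric coordinates, the squared distance of a point of an equilateral triangle of side 1
  to a vertex is an affine function of the weight of this vertex. The three vertices of a triangle of
  the Eisenstein lattice represent the three classes modulo \<open>\<surd>-3\<close>.\<close>

lemma triangle_weights:
  fixes z :: complex
  shows "\<exists>(f :: int \<Rightarrow> real) v. (\<forall>c. f c \<ge> 0) \<and> (\<forall>c. f c + f (c + 1) + f (c - 1) = 1) \<and> (\<forall>c. f (c + 3) = f c) \<and>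
    (\<forall>c. \<exists>m n. v c = eis m n \<and> 3 dvd m - n - c) \<and>
    (\<forall>c. (cmod (z - v c))\<^sup>2 = 1 - f c - (f c * f (c + 1) + f (c + 1) * f (c - 1) + f c * f (c - 1)))"
proof -
  define t where "t = Im z * 2 / sqrt 3"
  define s where "s = Re z - t / 2"
  have z: "z = of_real s + of_real t * omega6"
    by (simp add: complex_eq_iff omega6_def s_def t_def)
  define m where "m = \<lfloor>s\<rfloor>"
  define n where "n = \<lfloor>t\<rfloor>"
  define k where "k = m - n"
  define a where "a = s - m"
  define b where "b = t - n"
  have ab: "0 \<le> a" "a < 1" "0 \<le> b" "b < 1" unfolding a_def b_def m_def n_def by linarith+
  \<comment> \<open>The unit rhombus is cut along a diagonal. Both halves contain the vertices
    \<open>(m + 1, n)\<close> and \<open>(m, n + 1)\<close>; their third vertices,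
    \<open>(m, n)\<close> and \<open>(m + 1, n + 1)\<close>, are both of class
    \<open>k\<close>.\<close>
  obtain l0 l1 l2 m0 n0 where l: "l0 \<ge> 0" "l1 \<ge> 0" "l2 \<ge> 0" "l0 + l1 + l2 = (1::real)"
    and v: "3 dvd m0 - n0 - k"
      "(cmod (z - eis m0 n0))\<^sup>2 = l1\<^sup>2 + l1 * l2 + l2\<^sup>2"
      "(cmod (z - eis (m + 1) n))\<^sup>2 = l0\<^sup>2 + l0 * l2 + l2\<^sup>2"
      "(cmod (z - eis m (n + 1)))\<^sup>2 = l0\<^sup>2 + l0 * l1 + l1\<^sup>2"
  proof (cases "a + b \<le> 1")
    case True
    show ?thesis
      by (rule that[of "1 - a - b" a b m n], unfold z norm_eis_shift,
        use ab True in \<open>simp_all add: k_def a_def b_def power2_eq_square algebra_simps\<close>)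
  next
    case False
    show ?thesis
      by (rule that[of "a + b - 1" "1 - b" "1 - a" "m + 1" "n + 1"], unfold z norm_eis_shift,
        use ab False in \<open>simp_all add: k_def a_def b_def power2_eq_square algebra_simps\<close>)
  qed
  define r where "r c = (c - k) mod 3" for c :: int
  define f where "f c = (if r c = 0 then l0 else if r c = 1 then l1 else l2)" for c
  define v where "v c = (if r c = 0 then eis m0 n0 else if r c = 1 then eis (m + 1) n else eis m (n + 1))" for c
  have r: "r c = 0 \<and> r (c + 1) = 1 \<and> r (c - 1) = 2 \<or> r c = 1 \<and> r (c + 1) = 2 \<and> r (c - 1) = 0
      \<or> r c = 2 \<and> r (c + 1) = 0 \<and> r (c - 1) = 1" for c
    unfolding r_def by presburger
  have "f (c + 3) = f c" for c
  proof -
    have "r (c + 3) = r c" unfolding r_def by presburger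
    then show ?thesis unfolding f_def by simp
  qed
  moreover have "f c \<ge> 0" for c using l unfolding f_def by auto
  moreover have "f c + f (c + 1) + f (c - 1) = 1" for c
    using r[of c] l(4) unfolding f_def by auto
  moreover have "\<exists>m n. v c = eis m n \<and> 3 dvd m - n - c" for c
  proof -
    consider "r c = 0" | "r c = 1" | "r c = 2" using r by blast
    then show ?thesis
    proof cases
      case 1
      then have "3 dvd m0 - n0 - c" using v(1) unfolding r_def by presburger
      then show ?thesis using 1 unfolding v_def by auto
    next
      case 2
      then have "3 dvd (m + 1) - n - c" unfolding r_def k_def by presburger
      then show ?thesis using 2 unfolding v_def by auto
    next
      case 3
      then have "3 dvd m - (n + 1) - c" unfolding r_def k_def by presburger
      then show ?thesis using 3 unfolding v_def by auto
    qed
  qed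
  moreover have "(cmod (z - v c))\<^sup>2 = 1 - f c - (f c * f (c + 1) + f (c + 1) * f (c - 1) + f c * f (c - 1))" for c
  proof -
    note t = triangle_vertex_dist
    consider "r c = 0" | "r c = 1" | "r c = 2" using r by blast
    then show ?thesis
    proof cases
      case 1
      then show ?thesis
        using r[of c] v(2) t[of l0 l1 l2] l(4) unfolding v_def f_def by auto
    next
      case 2
      then show ?thesis
        using r[of c] v(3) t[of l1 l0 l2] l(4) unfolding v_def f_def by (auto simp: algebra_simps)
    next
      case 3
      then show ?thesis
        using r[of c] v(4) t[of l2 l0 l1] l(4) unfolding v_def f_def by (auto simp: algebra_simps)
    qed
  qed
  ultimately show ?thesis by blast
qed

text \<open>The estimate for a single triangle in \<open>three_weights_ineq\<close>, where
  \<open>g\<close> and \<open>k\<close> are the gaps between the largest weight and the other two.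
  It is sharp at \<open>g = k = t\<close>, and the difference of the sides is a sum of products of
  the constraints and of squares.\<close>

lemma gap_bound:
  fixes t g k :: real
  assumes "0 \<le> t" "t \<le> g" "0 \<le> k" "2 * g \<le> 1 + k" "2 * k \<le> 1 + g"
  shows "t\<^sup>2 + 2 * (1 - t) * min k t \<le> g + k - g\<^sup>2 - k\<^sup>2 + g * k"
proof (cases "t \<le> k")
  case True
  define u where "u = g - t"
  define v where "v = k - t"
  have "0 \<le> u * (1 - t - 2 * u + v)" "0 \<le> v * (1 - t - 2 * v + u)"
    by (rule mult_nonneg_nonneg; use assms True in \<open>simp add: u_def v_def\<close>)+
  then have "0 \<le> u * (1 - t - 2 * u + v) + v * (1 - t - 2 * v + u) + ((u - v)\<^sup>2 + u\<^sup>2 + v\<^sup>2) / 2"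
    by simp
  also have "\<dots> = g + k - g\<^sup>2 - k\<^sup>2 + g * k - (t\<^sup>2 + 2 * (1 - t) * t)"
    unfolding u_def v_def by (simp add: power2_eq_square field_simps)
  finally show ?thesis unfolding min_absorb2[OF True] by linarith
next
  case False
  define u where "u = g - t"
  have "0 \<le> u * (1 - 2 * t - 2 * u + k)" "0 \<le> (t - k) * (1 - 2 * t + k)"
    by (rule mult_nonneg_nonneg; use assms False in \<open>simp add: u_def\<close>)+
  then have "0 \<le> u * (1 - 2 * t - 2 * u + k) + u\<^sup>2 + (t - k) * (1 - 2 * t + k)"
    by simp
  also have "\<dots> = g + k - g\<^sup>2 - k\<^sup>2 + g * k - (t\<^sup>2 + 2 * (1 - t) * k)"
    unfolding u_def by (simp add: power2_eq_square algebra_simps)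
  finally show ?thesis unfolding min_absorb1[OF less_imp_le, OF False[unfolded not_le]] by linarith
qed

text \<open>The vectors \<open>a\<close>, \<open>x\<close>, \<open>y\<close> list the weights of a point in three triangles, \<open>a\<close> being the largest ones. The
  alternatives are the ways to change the class of the sum of the three chosen vertices by a given
  nonzero amount.\<close>

lemma three_weights_ineq:
  fixes a x y :: "3 \<Rightarrow> real"
  assumes w: "\<And>i. a i + x i + y i = 1" "\<And>i. 0 \<le> x i" "\<And>i. 0 \<le> y i" "\<And>i. x i \<le> a i" "\<And>i. y i \<le> a i"
  defines "Q \<equiv> (\<Sum>i\<in>UNIV. (a i)\<^sup>2 + (x i)\<^sup>2 + (y i)\<^sup>2)"
  shows "Q \<le> 2 * (x 1 + a 2 + a 3) - 1 \<or> Q \<le> 2 * (a 1 + x 2 + a 3) - 1 \<or> Q \<le> 2 * (a 1 + a 2 + x 3) - 1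
    \<or> Q \<le> 2 * (y 1 + y 2 + a 3) - 1 \<or> Q \<le> 2 * (y 1 + a 2 + y 3) - 1 \<or> Q \<le> 2 * (a 1 + y 2 + y 3) - 1"
proof -
  define g where "g i = a i - x i" for i
  define k where "k i = a i - y i" for i
  define \<phi> where "\<phi> i = g i + k i - (g i)\<^sup>2 - (k i)\<^sup>2 + g i * k i" for i
  have a: "a i = (1 + g i + k i) / 3" for i using w(1)[of i] unfolding g_def k_def by simp
  have x: "x i = (1 + k i - 2 * g i) / 3" for i using w(1)[of i] unfolding g_def k_def by simp
  have y: "y i = (1 + g i - 2 * k i) / 3" for i using w(1)[of i] unfolding g_def k_def by simp
  have gk: "0 \<le> g i" "0 \<le> k i" "2 * g i \<le> 1 + k i" "2 * k i \<le> 1 + g i" for i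
    using w(2-5)[of i] x[of i] y[of i] unfolding g_def k_def by auto
  have id: "2 * (a 1 + a 2 + a 3) - 1 - Q = 2/3 * (\<phi> 1 + \<phi> 2 + \<phi> 3)"
  proof -
    have e: "(a i)\<^sup>2 + (x i)\<^sup>2 + (y i)\<^sup>2 = 1/3 + 2/3 * (g i + k i - \<phi> i)" for i
      unfolding a x y \<phi>_def by (simp add: power2_eq_square field_simps)
    show ?thesis
      unfolding Q_def sum_3 e unfolding a by (simp add: field_simps)
  qed
  \<comment> \<open>The least loss among the six alternatives: one triangle passes from
    \<open>a\<close> to \<open>x\<close>, or two pass from \<open>a\<close> to \<open>y\<close>. By
    \<open>id\<close> it remains to show that the \<open>\<phi> i\<close> sum to at least
    \<open>3 * t\<close>.\<close>
  define t where "t = Min {g 1, g 2, g 3, k 1 + k 2, k 1 + k 3, k 2 + k 3}"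
  have t: "t \<le> g 1" "t \<le> g 2" "t \<le> g 3" "t \<le> k 1 + k 2" "t \<le> k 1 + k 3" "t \<le> k 2 + k 3"
    unfolding t_def by (intro Min_le; simp)+
  have tmem: "t \<in> {g 1, g 2, g 3, k 1 + k 2, k 1 + k 3, k 2 + k 3}"
    unfolding t_def by (rule Min_in) auto
  have t0: "0 \<le> t" using tmem gk by (auto intro: add_nonneg_nonneg)
  have t1: "t \<le> 1" using t(1) gk(3,4)[of 1] by linarith
  have tg: "t \<le> g i" for i using t exhaust_3[of i] by auto
  have "2 * (1 - t) * (3/2 * t) \<le> 2 * (1 - t) * (min (k 1) t + min (k 2) t + min (k 3) t)"
  proof (rule mult_left_mono)
    have "t \<le> min (k i) t + min (k j) t" if "t \<le> k i + k j" for i j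
      using that gk(2)[of i] gk(2)[of j] t0 by (simp add: min_def)
    from this[OF t(4)] this[OF t(5)] this[OF t(6)]
    show "3/2 * t \<le> min (k 1) t + min (k 2) t + min (k 3) t" by simp
  qed (use t1 in simp)
  moreover have "t\<^sup>2 + 2 * (1 - t) * min (k i) t \<le> \<phi> i" for i
    unfolding \<phi>_def using gap_bound[OF t0 tg gk(2-4)] .
  from this[of 1] this[of 2] this[of 3]
  have "3 * t\<^sup>2 + 2 * (1 - t) * (min (k 1) t + min (k 2) t + min (k 3) t) \<le> \<phi> 1 + \<phi> 2 + \<phi> 3"
    by (simp add: distrib_left)
  moreover have "3 * t\<^sup>2 + 2 * (1 - t) * (3/2 * t) = 3 * t"
    by (simp add: power2_eq_square field_simps)
  ultimately have "3 * t \<le> \<phi> 1 + \<phi> 2 + \<phi> 3" by linarith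
  then have "Q \<le> 2 * (a 1 + a 2 + a 3) - 2 * t - 1" using id by simp
  then show ?thesis using tmem unfolding g_def k_def by auto
qed

text \<open>In each coordinate the triangle vertex of largest weight is preferred. If the classes of
  the three vertices do not sum to 0 modulo 3, some vertices are exchanged, at a loss that
  \<open>three_weights_ineq\<close> controls.\<close>

lemma E6_dual_covering: "\<exists>l\<in>E6_dual. dist p l \<le> 1" for p :: "complex ^ 3"
proof -
  obtain f :: "3 \<Rightarrow> int \<Rightarrow> real" and v :: "3 \<Rightarrow> int \<Rightarrow> complex" where
    f: "\<And>i c. f i c \<ge> 0" "\<And>i c. f i c + f i (c + 1) + f i (c - 1) = 1" "\<And>i c. f i (c + 3) = f i c"
    and v: "\<And>i c. \<exists>m n. v i c = eis m n \<and> 3 dvd m - n - c"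
      "\<And>i c. (cmod (p $ i - v i c))\<^sup>2
        = 1 - f i c - (f i c * f i (c + 1) + f i (c + 1) * f i (c - 1) + f i c * f i (c - 1))"
    using triangle_weights[of "p $ _"] by metis
  have "\<exists>t. f i (t + 1) \<le> f i t \<and> f i (t - 1) \<le> f i t" for i
  proof -
    have "f i (-1) = f i 2" "f i 3 = f i 0" using f(3)[of i "-1"] f(3)[of i 0] by simp_all
    then consider "f i 1 \<le> f i 0" "f i (-1) \<le> f i 0" | "f i 2 \<le> f i 1" "f i 0 \<le> f i 1"
      | "f i 3 \<le> f i 2" "f i 1 \<le> f i 2" by linarith
    then show ?thesis
    proof cases
      case 1 then show ?thesis by (intro exI[of _ 0]) simp
    next
      case 2 then show ?thesis by (intro exI[of _ 1]) simp
    next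
      case 3 then show ?thesis by (intro exI[of _ 2]) simp
    qed
  qed
  then obtain t where t: "\<And>i. f i (t i + 1) \<le> f i (t i)" "\<And>i. f i (t i - 1) \<le> f i (t i)" by metis
  define Q where "Q = (\<Sum>i\<in>UNIV. (f i (t i))\<^sup>2 + (f i (t i + 1))\<^sup>2 + (f i (t i - 1))\<^sup>2)"
  \<comment> \<open>The squared distance to the chosen lattice point is 3/2 minus the sum of the
    chosen weights plus \<open>Q / 2\<close>, so \<open>le\<close> says precisely that it is at most
    1.\<close>
  have reduce: ?thesis if d: "3 dvd t 1 + t 2 + t 3 + (d 1 + d 2 + d 3)" "\<And>i. d i \<in> {-1, 0, 1}"
    and le: "Q \<le> 2 * (f 1 (t 1 + d 1) + f 2 (t 2 + d 2) + f 3 (t 3 + d 3)) - 1" for d :: "3 \<Rightarrow> int"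
  proof -
    have "\<exists>m n. v i (t i + d i) = eis m n \<and> 3 dvd m - n - (t i + d i)" for i
      by (rule v(1))
    then obtain m n where mn: "\<And>i. v i (t i + d i) = eis (m i) (n i)"
      "\<And>i. 3 dvd m i - n i - (t i + d i)"
      by metis
    define l :: "complex ^ 3" where "l = (\<chi> i. v i (t i + d i))"
    have "3 dvd (\<Sum>i\<in>UNIV. m i - n i)"
    proof -
      have "(\<Sum>i\<in>UNIV. m i - n i) = (m 1 - n 1 - (t 1 + d 1)) + (m 2 - n 2 - (t 2 + d 2))
          + (m 3 - n 3 - (t 3 + d 3)) + (t 1 + t 2 + t 3 + (d 1 + d 2 + d 3))"
        by (simp add: sum_3)
      then show ?thesis by (simp only:) (intro dvd_add mn(2) d(1))
    qed
    then have "l \<in> E6_dual" by (rule E6_dual_I) (simp add: l_def mn(1))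
    moreover have "(cmod (p $ i - l $ i))\<^sup>2 = 1/2 - f i (t i + d i)
        + ((f i (t i))\<^sup>2 + (f i (t i + 1))\<^sup>2 + (f i (t i - 1))\<^sup>2) / 2" for i
    proof -
      have *: "a * b + b * c + a * c = 1/2 - (a\<^sup>2 + b\<^sup>2 + c\<^sup>2) / 2" if "a + b + c = 1" for a b c :: real
      proof -
        have c: "c = 1 - a - b" using that by simp
        show ?thesis unfolding c by (simp add: power2_eq_square field_simps)
      qed
      have h: "f i (t i + 1 + 1) = f i (t i - 1)" "f i (t i - 1 - 1) = f i (t i + 1)"
        using f(3)[of i "t i - 1"] f(3)[of i "t i - 2"] by (simp_all add: algebra_simps)
      note q = *[OF f(2)[of i "t i"]]
      consider "d i = 0" | "d i = 1" | "d i = -1" using d(2)[of i] by blast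
      then show ?thesis
      proof cases
        case 1
        then show ?thesis using v(2)[of i "t i"] q by (simp add: l_def)
      next
        case 2
        have "(cmod (p $ i - v i (t i + 1)))\<^sup>2 = 1 - f i (t i + 1) - (f i (t i) * f i (t i + 1)
            + f i (t i + 1) * f i (t i - 1) + f i (t i) * f i (t i - 1))"
          using v(2)[of i "t i + 1"] unfolding h(1) by (simp add: mult.commute)
        then show ?thesis unfolding q by (simp add: l_def 2)
      next
        case 3
        have "(cmod (p $ i - v i (t i - 1)))\<^sup>2 = 1 - f i (t i - 1) - (f i (t i) * f i (t i + 1)
            + f i (t i + 1) * f i (t i - 1) + f i (t i) * f i (t i - 1))"
          using v(2)[of i "t i - 1"] unfolding h(2) by (simp add: mult.commute)
        then show ?thesis unfolding q by (simp add: l_def 3)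
      qed
    qed
    then have "(norm (p - l))\<^sup>2 = 3/2 - (f 1 (t 1 + d 1) + f 2 (t 2 + d 2) + f 3 (t 3 + d 3)) + Q / 2"
      unfolding norm_sq_complex_vec Q_def sum_3 by (simp add: add_divide_distrib)
    then have "(norm (p - l))\<^sup>2 \<le> 1" using le by simp
    ultimately show ?thesis by (intro bexI[of _ l]) (simp_all add: dist_norm abs_square_le_1)
  qed
  show ?thesis
  proof (cases "3 dvd t 1 + t 2 + t 3")
    case True
    have sq: "(f i (t i))\<^sup>2 + (f i (t i + 1))\<^sup>2 + (f i (t i - 1))\<^sup>2 \<le> f i (t i)" for i
    proof -
      have "f i (t i) * f i (t i) + f i (t i + 1) * f i (t i + 1) + f i (t i - 1) * f i (t i - 1)
          \<le> f i (t i) * f i (t i) + f i (t i) * f i (t i + 1) + f i (t i) * f i (t i - 1)"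
        by (intro add_mono mult_right_mono t f(1)) simp
      also have "\<dots> = f i (t i) * (f i (t i) + f i (t i + 1) + f i (t i - 1))" by (simp add: algebra_simps)
      finally show ?thesis by (simp add: f(2) power2_eq_square)
    qed
    have third: "1/3 \<le> f i (t i)" for i using t[of i] f(2)[of i "t i"] by linarith
    show ?thesis
    proof (rule reduce[of "\<lambda>_. 0"])
      have "Q \<le> f 1 (t 1) + f 2 (t 2) + f 3 (t 3)"
        unfolding Q_def sum_3 by (intro add_mono sq)
      then show "Q \<le> 2 * (f 1 (t 1 + 0) + f 2 (t 2 + 0) + f 3 (t 3 + 0)) - 1"
        using third[of 1] third[of 2] third[of 3] by simp
      show "3 dvd t 1 + t 2 + t 3 + (0 + 0 + 0)" using True by simp
    qed simp
  next
    case False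
    \<comment> \<open>The residue to be removed: either one class is lowered by \<open>s\<close>, or
      two are raised by \<open>s\<close>, because \<open>2 * s\<close> is congruent to
      \<open>- s\<close> modulo 3.\<close>
    define s :: int where "s = (if (t 1 + t 2 + t 3) mod 3 = 1 then 1 else -1)"
    have s: "s = 1 \<or> s = -1" "3 dvd t 1 + t 2 + t 3 - s"
    proof -
      have "n mod 3 = 1 \<or> n mod 3 = 2" if "\<not> 3 dvd n" for n :: int using that by presburger
      then have "(t 1 + t 2 + t 3) mod 3 = 1 \<or> (t 1 + t 2 + t 3) mod 3 = 2" using False by blast
      moreover have "3 dvd n - 1" if "n mod 3 = 1" for n :: int using that by presburger
      moreover have "3 dvd n - -1" if "n mod 3 = 2" for n :: int using that by presburger
      ultimately show "s = 1 \<or> s = -1" "3 dvd t 1 + t 2 + t 3 - s" unfolding s_def by auto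
    qed
    define x where "x i = f i (t i - s)" for i
    define y where "y i = f i (t i + s)" for i
    have Q: "Q = (\<Sum>i\<in>UNIV. (f i (t i))\<^sup>2 + (x i)\<^sup>2 + (y i)\<^sup>2)"
      unfolding Q_def x_def y_def using s(1) by (auto intro!: sum.cong)
    have sums: "f i (t i) + x i + y i = 1" "x i \<le> f i (t i)" "y i \<le> f i (t i)" "0 \<le> x i" "0 \<le> y i" for i
      using s(1) f(2)[of i "t i"] t[of i] f(1) unfolding x_def y_def by auto
    have r: ?thesis if "Q \<le> 2 * (f 1 (t 1 + d1 * s) + f 2 (t 2 + d2 * s) + f 3 (t 3 + d3 * s)) - 1"
      "(d1, d2, d3) \<in> {(-1, 0, 0), (0, -1, 0), (0, 0, -1), (1, 1, 0), (1, 0, 1), (0, 1, 1)}" for d1 d2 d3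
    proof (rule reduce[of "\<lambda>i. (if i = 1 then d1 else if i = 2 then d2 else d3) * s"])
      show "(if i = 1 then d1 else if i = 2 then d2 else d3) * s \<in> {- 1, 0, 1}" for i :: 3
        using that(2) s(1) by auto
      have "d1 + d2 + d3 = -1 \<or> d1 + d2 + d3 = 2" using that(2) by auto
      then have "\<exists>w. d1 + d2 + d3 = 3 * w - 1" by presburger
      then obtain w where w: "d1 + d2 + d3 = 3 * w - 1" by blast
      have "t 1 + t 2 + t 3 + (d1 + d2 + d3) * s = (t 1 + t 2 + t 3 - s) + 3 * (w * s)"
        unfolding w by (simp add: algebra_simps)
      then have "3 dvd t 1 + t 2 + t 3 + (d1 + d2 + d3) * s" using s(2) by (metis dvd_add dvd_triv_left)
      then show "3 dvd t 1 + t 2 + t 3 + ((if 1 = (1::3) then d1 else if 1 = (2::3) then d2 else d3) * s +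
          (if 2 = (1::3) then d1 else if 2 = (2::3) then d2 else d3) * s +
          (if 3 = (1::3) then d1 else if 3 = (2::3) then d2 else d3) * s)"
        by (simp add: algebra_simps)
    qed (use that(1) in simp)
    show ?thesis
      using three_weights_ineq[of "\<lambda>i. f i (t i)" x y, OF sums(1,4,5,2,3), folded Q]
        r[of "-1" 0 0] r[of 0 "-1" 0] r[of 0 0 "-1"] r[of 1 1 0] r[of 1 0 1] r[of 0 1 1]
      by (auto simp: x_def y_def)
  qed
qed

text \<open>Reduction modulo the prime \<open>2 + omega6\<close> of norm 7, which sends
  \<open>omega6\<close> to -2. The two floors recover \<open>m\<close> and \<open>n\<close> from
  \<open>eis m n\<close>.\<close>

definition eis_digit :: "complex \<Rightarrow> int" where
  "eis_digit z = (\<lfloor>Re z - Im z / sqrt 3\<rfloor> - 2 * \<lfloor>Im z * 2 / sqrt 3\<rfloor>) mod 7"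

lemma eis_digit_eis: "eis_digit (eis m n) = (m - 2 * n) mod 7"
  by (simp add: eis_digit_def eis_Re_Im)

definition E6_color :: "complex ^ 3 \<Rightarrow> nat" where
  "E6_color x = nat (eis_digit (x $ 1) + 7 * (eis_digit (x $ 2) + 7 * eis_digit (x $ 3)))"

lemma eis_digit_bounds: "0 \<le> eis_digit z" "eis_digit z < 7"
  by (simp_all add: eis_digit_def)

lemma E6_color_less: "E6_color x < 343"
proof -
  have "eis_digit z \<le> 6" for z using eis_digit_bounds(2)[of z] by simp
  then have "eis_digit (x $ 1) + 7 * (eis_digit (x $ 2) + 7 * eis_digit (x $ 3)) \<le> 6 + 7 * (6 + 7 * 6)"
    by (intro add_mono mult_left_mono) simp_all
  then have "E6_color x \<le> 342" unfolding E6_color_def by (simp add: nat_le_iff)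
  then show ?thesis by simp
qed

text \<open>Each coordinate of the difference is divided by \<open>2 + omega6\<close>. As this is
  congruent to 1 modulo sqrt (-3), the quotients have the same classes and stay in the
  lattice.\<close>

lemma E6_color_eq:
  assumes "x \<in> E6_dual" "y \<in> E6_dual" and eq: "E6_color x = E6_color y"
  shows "\<exists>r\<in>E6_dual. x - y = 2 *\<^sub>R r + omega6_mult r"
proof -
  obtain m n where x: "3 dvd (\<Sum>i\<in>UNIV. m i - n i)" "\<And>i. x $ i = eis (m i) (n i)"
    using E6_dual_E[OF assms(1)] by blast
  obtain m' n' where y: "3 dvd (\<Sum>i\<in>UNIV. m' i - n' i)" "\<And>i. y $ i = eis (m' i) (n' i)"
    using E6_dual_E[OF assms(2)] by blast
  have nonneg: "0 \<le> eis_digit (z $ 1) + 7 * (eis_digit (z $ 2) + 7 * eis_digit (z $ 3))" for z :: "complex ^ 3"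
    by (intro add_nonneg_nonneg mult_nonneg_nonneg eis_digit_bounds) simp_all
  note * = eq[unfolded E6_color_def, THEN eq_nat_nat_iff[OF nonneg nonneg, THEN iffD1]]
  note 1 = base_digit[OF eis_digit_bounds eis_digit_bounds *]
  note 2 = base_digit[OF eis_digit_bounds eis_digit_bounds 1(2)]
  have digits: "eis_digit (x $ i) = eis_digit (y $ i)" for i
    using 1(1) 2 exhaust_3[of i] by metis
  have "\<exists>k. m i - m' i = 2 * (n i - n' i) + 7 * k" for i
  proof -
    have "(m i - 2 * n i) mod 7 = (m' i - 2 * n' i) mod 7"
      using digits[of i] unfolding x(2) y(2) eis_digit_eis .
    then have "7 dvd (m i - 2 * n i) - (m' i - 2 * n' i)" by (simp only: mod_eq_dvd_iff)
    then obtain k where "(m i - 2 * n i) - (m' i - 2 * n' i) = 7 * k" by (elim dvdE)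
    then show ?thesis by (intro exI[of _ k]) simp
  qed
  then obtain k where k: "\<And>i. m i - m' i = 2 * (n i - n' i) + 7 * k i" by metis
  define r :: "complex ^ 3" where "r = (\<chi> i. eis (n i - n' i + 3 * k i) (- k i))"
  have "r \<in> E6_dual"
  proof (rule E6_dual_I[of "\<lambda>i. n i - n' i + 3 * k i" "\<lambda>i. - k i"])
    have "n i - n' i + 3 * k i - - k i = (m i - n i) - (m' i - n' i) - 3 * k i" for i
      using k[of i] by simp
    then have "(\<Sum>i\<in>UNIV. n i - n' i + 3 * k i - - k i)
        = (\<Sum>i\<in>UNIV. m i - n i) - (\<Sum>i\<in>UNIV. m' i - n' i) - 3 * (\<Sum>i\<in>UNIV. k i)"
      by (simp only: sum_subtractf sum_distrib_left)
    then show "3 dvd (\<Sum>i\<in>UNIV. n i - n' i + 3 * k i - - k i)"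
      by (simp only:) (intro dvd_diff x(1) y(1) dvd_triv_left)
  qed (simp add: r_def)
  moreover have "x - y = 2 *\<^sub>R r + omega6_mult r"
    unfolding vec_eq_iff
  proof
    fix i
    have r: "r $ i = eis (n i - n' i + 3 * k i) (- k i)" by (simp add: r_def)
    have "(x - y) $ i = eis (m i - m' i) (n i - n' i)"
      by (simp add: x y eis_def algebra_simps)
    also have "\<dots> = eis (2 * (n i - n' i + 3 * k i) + k i) (2 * (- k i) + (n i - n' i + 2 * k i))"
      by (rule arg_cong2[where f = eis]) (use k[of i] in simp_all)
    also have "\<dots> = 2 *\<^sub>R eis (n i - n' i + 3 * k i) (- k i) + eis (k i) (n i - n' i + 2 * k i)"
      by (simp add: eis_def scaleR_conv_of_real algebra_simps)
    finally show "(x - y) $ i = (2 *\<^sub>R r + omega6_mult r) $ i"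
      by (simp add: omega6_mult_def r omega6_mult_eis add.commute)
  qed
  ultimately show ?thesis by (rule bexI[rotated])
qed

interpretation E6: eisenstein_lattice E6_dual omega6_mult E6_color 343
  by unfold_locales
    (fact E6_dual_diff E6_dual_omega6_mult omega6_mult_norm omega6_mult_inner E6_dual_norm
      E6_dual_covering E6_color_less E6_color_eq)+

section \<open>The dual of \<open>A\<^sub>n\<close>\<close>

text \<open>The orthogonal projection of the integer vectors along (1, ..., 1). In \<open>m\<close>
  coordinates its image is the dual of the root lattice of rank \<open>m - 1\<close>.\<close>

definition An_dual_proj :: "('n::finite \<Rightarrow> int) \<Rightarrow> real ^ 'n" where
  "An_dual_proj z = (\<chi> i. of_int (z i) - of_int (\<Sum>j\<in>UNIV. z j) / of_nat CARD('n))"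

definition sum_zero :: "(real ^ 'n) set" where
  "sum_zero = {x. (\<Sum>i\<in>UNIV. x $ i) = 0}"

text \<open>A permutohedron, given by the Voronoi half-spaces of the projected 0/1 vectors.\<close>

definition An_cell :: "(real ^ 'n) set" where
  "An_cell = {u \<in> sum_zero. \<forall>S. (\<Sum>i\<in>S. u $ i) \<le> real (card S) * (real CARD('n) - card S) / (2 * CARD('n))}"

lemma An_dual_proj_diff: "An_dual_proj z - An_dual_proj w = An_dual_proj (\<lambda>i. z i - w i)"
  unfolding An_dual_proj_def vec_eq_iff by (simp add: sum_subtractf diff_divide_distrib)

lemma An_dual_proj_sum_zero: "An_dual_proj z \<in> sum_zero" for z :: "'n::finite \<Rightarrow> int"
  by (simp add: An_dual_proj_def sum_zero_def sum_subtractf)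

lemma inner_An_dual_proj:
  assumes "x \<in> sum_zero"
  shows "x \<bullet> An_dual_proj z = (\<Sum>i\<in>UNIV. x $ i * of_int (z i))"
proof -
  define c where "c = real_of_int (\<Sum>j\<in>UNIV. z j) / of_nat CARD('a)"
  have "x \<bullet> An_dual_proj z = (\<Sum>i\<in>UNIV. x $ i * of_int (z i)) - (\<Sum>i\<in>UNIV. x $ i) * c"
    unfolding An_dual_proj_def inner_vec_def c_def[symmetric]
    by (simp add: right_diff_distrib sum_subtractf sum_distrib_right)
  then show ?thesis using assms by (simp add: sum_zero_def)
qed

lemma norm_An_dual_proj:
  fixes z :: "'n::finite \<Rightarrow> int"
  shows "CARD('n) * (norm (An_dual_proj z))\<^sup>2 = of_int (CARD('n) * (\<Sum>i\<in>UNIV. (z i)\<^sup>2) - (\<Sum>i\<in>UNIV. z i)\<^sup>2)"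
proof -
  have "(norm (An_dual_proj z))\<^sup>2
      = (\<Sum>i\<in>UNIV. (of_int (z i))\<^sup>2 - of_int (z i) * (of_int (\<Sum>j\<in>UNIV. z j) / of_nat CARD('n)))"
    unfolding power2_norm_eq_inner inner_An_dual_proj[OF An_dual_proj_sum_zero]
    by (intro sum.cong refl) (simp add: An_dual_proj_def power2_eq_square algebra_simps)
  also have "\<dots> = of_int (\<Sum>i\<in>UNIV. (z i)\<^sup>2) - of_int ((\<Sum>i\<in>UNIV. z i)\<^sup>2) / of_nat CARD('n)"
    unfolding sum_subtractf sum_distrib_right[symmetric] by (simp add: power2_eq_square)
  finally show ?thesis by (simp add: field_simps)
qed

lemma norm_An_dual_proj_indicator:
  fixes S :: "'n::finite set"
  shows "(norm (An_dual_proj (\<lambda>i. of_bool (i \<in> S))))\<^sup>2 = real (card S) * (real CARD('n) - card S) / CARD('n)"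
proof -
  have "(\<Sum>i\<in>UNIV. of_bool (i \<in> S) :: int) = card S" by simp
  moreover have "(of_bool (i \<in> S) :: int)\<^sup>2 = of_bool (i \<in> S)" for i by simp
  ultimately show ?thesis
    using norm_An_dual_proj[of "\<lambda>i. of_bool (i \<in> S)"] by (simp add: field_simps power2_eq_square)
qed

lemma inner_An_dual_proj_indicator:
  fixes S :: "'n::finite set"
  assumes "x \<in> sum_zero"
  shows "x \<bullet> An_dual_proj (\<lambda>i. of_bool (i \<in> S)) = (\<Sum>i\<in>S. x $ i)"
proof -
  have "(\<Sum>i\<in>UNIV. x $ i * of_int (of_bool (i \<in> S))) = (\<Sum>i\<in>S. x $ i)"
    by (intro sum.mono_neutral_cong_right) auto
  then show ?thesis unfolding inner_An_dual_proj[OF assms] .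
qed

lemma sum_zero_diff: "x \<in> sum_zero \<Longrightarrow> y \<in> sum_zero \<Longrightarrow> x - y \<in> sum_zero"
  by (simp add: sum_zero_def sum_subtractf)

lemma An_cell_cover:
  fixes p :: "real ^ 'n"
  assumes "p \<in> sum_zero"
  shows "\<exists>z. p - An_dual_proj z \<in> An_cell"
proof -
  let ?L = "range (An_dual_proj :: ('n \<Rightarrow> int) \<Rightarrow> real ^ 'n)"
  have diff: "x - y \<in> ?L" if "x \<in> ?L" "y \<in> ?L" for x y
    using that by (auto simp: An_dual_proj_diff)
  \<comment> \<open>\<open>CARD('n)\<close> times the squared norm is an integer. This crude bound
    serves only for the existence of a nearest point.\<close>
  have norm: "1 / CARD('n) \<le> norm x" if "x \<in> ?L" "x \<noteq> 0" for x
  proof -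
    obtain z where x: "x = An_dual_proj z" using \<open>x \<in> ?L\<close> by blast
    define N where "N = int CARD('n) * (\<Sum>i\<in>UNIV. (z i)\<^sup>2) - (\<Sum>i\<in>UNIV. z i)\<^sup>2"
    have N: "CARD('n) * (norm x)\<^sup>2 = of_int N"
      unfolding x N_def by (rule norm_An_dual_proj)
    moreover have "0 < CARD('n) * (norm x)\<^sup>2" using \<open>x \<noteq> 0\<close> by simp
    ultimately have "1 \<le> CARD('n) * (norm x)\<^sup>2" by simp
    then have "1 / CARD('n) \<le> (norm x)\<^sup>2" by (simp add: field_simps)
    moreover have "(1 / CARD('n))\<^sup>2 \<le> 1 / CARD('n)"
      by (simp add: power2_eq_square divide_simps)
    ultimately have "(1 / CARD('n))\<^sup>2 \<le> (norm x)\<^sup>2" by linarith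
    then show ?thesis by (rule power2_le_imp_le) simp
  qed
  have ne: "?L \<noteq> {}" and pos: "0 < 1 / real CARD('n)" by simp_all
  obtain l where l: "l \<in> ?L" "\<And>v. v \<in> ?L \<Longrightarrow> (p - l) \<bullet> v \<le> (norm v)\<^sup>2 / 2"
    using nearest_lattice_point[OF ne diff pos norm] by metis
  then obtain z where z: "l = An_dual_proj z" by blast
  have 0: "p - l \<in> sum_zero" unfolding z using assms An_dual_proj_sum_zero by (rule sum_zero_diff)
  have "(\<Sum>i\<in>S. (p - l) $ i) \<le> real (card S) * (real CARD('n) - card S) / (2 * CARD('n))" for S
    using l(2)[of "An_dual_proj (\<lambda>i. of_bool (i \<in> S))"]
    unfolding inner_An_dual_proj_indicator[OF 0] norm_An_dual_proj_indicator by (simp add: mult.commute)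
  then show ?thesis using 0 z unfolding An_cell_def by blast
qed

text \<open>Summation by parts: the partial sums of \<open>c - b\<close> are nonnegative with total
  0, so decreasing weights favour \<open>c\<close>.\<close>

lemma abel_sum_le:
  fixes a b c :: "nat \<Rightarrow> real"
  assumes dec: "\<And>i. Suc i < m \<Longrightarrow> a (Suc i) \<le> a i"
    and le: "\<And>k. k < m \<Longrightarrow> (\<Sum>i<k. b i) \<le> (\<Sum>i<k. c i)" and eq: "(\<Sum>i<m. b i) = (\<Sum>i<m. c i)"
  shows "(\<Sum>i<m. a i * b i) \<le> (\<Sum>i<m. a i * c i)"
proof (cases m)
  case (Suc n)
  define d where "d i = c i - b i" for i
  have "a k * (\<Sum>i<Suc k. d i) \<le> (\<Sum>i<Suc k. a i * d i)" if "k \<le> n" for k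
    using that
  proof (induction k)
    case (Suc k)
    have "0 \<le> (\<Sum>i<Suc k. d i)"
      using le[of "Suc k"] Suc.prems \<open>m = Suc n\<close> unfolding d_def sum_subtractf by simp
    then have "a (Suc k) * (\<Sum>i<Suc k. d i) \<le> a k * (\<Sum>i<Suc k. d i)"
      using dec[of k] Suc.prems \<open>m = Suc n\<close> by (intro mult_right_mono) auto
    also have "\<dots> \<le> (\<Sum>i<Suc k. a i * d i)" using Suc by simp
    finally show ?case by (simp add: distrib_left)
  qed simp
  from this[of n] have "0 \<le> (\<Sum>i<m. a i * d i)"
    using eq unfolding Suc d_def sum_subtractf by simp
  then show ?thesis unfolding d_def by (simp add: right_diff_distrib sum_subtractf)
qed simp

lemma decreasing_enumeration:
  fixes w :: "'n::finite \<Rightarrow> real"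
  obtains e :: "nat \<Rightarrow> 'n" where "bij_betw e {..<CARD('n)} UNIV"
    "\<And>i. Suc i < CARD('n) \<Longrightarrow> w (e (Suc i)) \<le> w (e i)"
proof -
  obtain xs0 :: "'n list" where xs0: "set xs0 = UNIV" "distinct xs0"
    using finite_distinct_list[of "UNIV :: 'n set"] by auto
  define xs where "xs = sort_key (\<lambda>i. - w i) xs0"
  have xs: "set xs = UNIV" "distinct xs" "sorted (map (\<lambda>i. - w i) xs)"
    unfolding xs_def using xs0 by simp_all
  have len: "length xs = CARD('n)" using xs distinct_card by metis
  show ?thesis
  proof (rule that[of "(!) xs"])
    show "bij_betw ((!) xs) {..<CARD('n)} UNIV"
      using bij_betw_nth[OF xs(2)] len xs(1) by simp
    show "w (xs ! Suc i) \<le> w (xs ! i)" if "Suc i < CARD('n)" for i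
      using sorted_nth_mono[OF xs(3), of i "Suc i"] that len by simp
  qed
qed

text \<open>A cell vector, sorted decreasingly, is majorized by
  \<open>\<rho> = (m - 1, m - 3, \<dots>, 1 - m) / (2 m)\<close>, so its norm is at most that of \<open>\<rho>\<close>.\<close>

lemma An_cell_norm:
  fixes w :: "real ^ 'n"
  assumes "w \<in> An_cell"
  shows "(norm w)\<^sup>2 \<le> (real CARD('n) ^ 2 - 1) / (12 * CARD('n))"
proof -
  define m where "m = CARD('n)"
  have m: "m > 0" unfolding m_def by simp
  obtain e where e: "bij_betw e {..<m} (UNIV :: 'n set)" "\<And>i. Suc i < m \<Longrightarrow> w $ e (Suc i) \<le> w $ e i"
    using decreasing_enumeration[of "($) w"] unfolding m_def by metis
  define a where "a i = w $ e i" for i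
  define \<rho> where "\<rho> i = (real m - 1 - 2 * real i) / (2 * m)" for i
  have psum: "(\<Sum>i<k. \<rho> i) = real k * (real m - k) / (2 * m)" for k
    by (induction k) (use m in \<open>simp_all add: \<rho>_def field_simps\<close>)
  have asum: "(\<Sum>i<k. a i) = (\<Sum>i\<in>e ` {..<k}. w $ i)" "card (e ` {..<k}) = k" if "k \<le> m" for k
  proof -
    have "inj_on e {..<k}" using e(1) that by (meson bij_betw_def inj_on_subset lessThan_subset_iff)
    then show "(\<Sum>i<k. a i) = (\<Sum>i\<in>e ` {..<k}. w $ i)" "card (e ` {..<k}) = k"
      unfolding a_def by (simp_all add: sum.reindex card_image)
  qed
  have le: "(\<Sum>i<k. a i) \<le> (\<Sum>i<k. \<rho> i)" if "k < m" for k
  proof -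
    have "(\<Sum>i\<in>e ` {..<k}. w $ i) \<le> real (card (e ` {..<k})) * (real m - card (e ` {..<k})) / (2 * m)"
      using assms unfolding An_cell_def m_def by blast
    then show ?thesis using asum[of k] that by (simp add: psum)
  qed
  have "(\<Sum>i<m. a i) = (\<Sum>i\<in>UNIV. w $ i)"
    unfolding a_def by (rule sum.reindex_bij_betw[OF e(1)])
  then have eq: "(\<Sum>i<m. a i) = (\<Sum>i<m. \<rho> i)"
    using assms by (simp add: psum An_cell_def sum_zero_def)
  have "(norm w)\<^sup>2 = (\<Sum>i\<in>UNIV. (w $ i) * (w $ i))"
    unfolding power2_norm_eq_inner inner_vec_def by simp
  also have "\<dots> = (\<Sum>i<m. a i * a i)"
    unfolding a_def by (rule sum.reindex_bij_betw[OF e(1), symmetric])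
  also have "\<dots> \<le> (\<Sum>i<m. a i * \<rho> i)"
    using e(2) le eq unfolding a_def by (intro abel_sum_le) auto
  also have "\<dots> = (\<Sum>i<m. \<rho> i * a i)" by (simp add: mult.commute)
  also have "\<dots> \<le> (\<Sum>i<m. \<rho> i * \<rho> i)"
    using le eq m by (intro abel_sum_le) (auto simp: \<rho>_def divide_right_mono)
  also have "\<dots> = (real m ^ 2 - 1) / (12 * m)"
  proof -
    \<comment> \<open>The number \<open>k\<close> of terms is kept apart from \<open>x\<close> so
      that the induction goes through.\<close>
    have "(\<Sum>i<k. (x - 1 - 2 * real i)\<^sup>2)
        = k * (x - 1)\<^sup>2 - 2 * (x - 1) * k * (real k - 1) + 2 * k * (real k - 1) * (2 * real k - 1) / 3" for k x
      by (induction k) (simp_all add: power2_eq_square field_simps)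
    from this[where k = m and x = m] have "(\<Sum>i<m. (real m - 1 - 2 * real i)\<^sup>2) = real m * (real m ^ 2 - 1) / 3"
      by (simp add: power2_eq_square field_simps)
    moreover have "(\<Sum>i<m. \<rho> i * \<rho> i) = (\<Sum>i<m. (real m - 1 - 2 * real i)\<^sup>2) / (2 * real m)\<^sup>2"
      unfolding \<rho>_def sum_divide_distrib by (intro sum.cong refl) (simp add: power2_eq_square)
    ultimately have "(\<Sum>i<m. \<rho> i * \<rho> i) = real m * (real m ^ 2 - 1) / 3 / (2 * real m)\<^sup>2"
      by (simp only:)
    then show ?thesis using m by (simp add: power2_eq_square)
  qed
  finally show ?thesis unfolding m_def .
qed

text \<open>The functional is the projected indicator of \<open>S\<close>, of squared norm
  \<open>h\<close>. It is at least \<open>- h\<close> on \<open>u - v\<close>, by the cell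
  inequality of \<open>S\<close> for \<open>v\<close> and that of the complement for
  \<open>u\<close>; Cauchy-Schwarz does the rest.\<close>

lemma An_cell_separation:
  fixes u v :: "real ^ 'n" and S :: "'n set"
  assumes u: "u \<in> An_cell" and v: "v \<in> An_cell" and h: "h = real (card S) * (real CARD('n) - card S) / CARD('n)"
    and x: "x \<in> sum_zero" "(\<Sum>i\<in>S. x $ i) \<ge> h"
  shows "((\<Sum>i\<in>S. x $ i) - h)\<^sup>2 \<le> (norm (x + (u - v)))\<^sup>2 * h"
proof -
  have uv: "u \<in> sum_zero" "v \<in> sum_zero" using u v unfolding An_cell_def by auto
  have "(\<Sum>i\<in>- S. u $ i) \<le> real (card (- S)) * (real CARD('n) - card (- S)) / (2 * CARD('n))"
    using u unfolding An_cell_def by blast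
  moreover have "(\<Sum>i\<in>- S. u $ i) = - (\<Sum>i\<in>S. u $ i)"
  proof -
    have "(\<Sum>i\<in>S. u $ i) + (\<Sum>i\<in>- S. u $ i) = (\<Sum>i\<in>UNIV. u $ i)"
      by (subst sum.union_disjoint[symmetric]) auto
    then show ?thesis using uv(1) unfolding sum_zero_def by simp
  qed
  moreover have "real (card (- S)) = real CARD('n) - card S"
    by (simp add: Compl_eq_Diff_UNIV card_Diff_subset of_nat_diff card_mono)
  ultimately have "- (\<Sum>i\<in>S. u $ i) \<le> h / 2" unfolding h by (simp add: mult.commute)
  moreover have "(\<Sum>i\<in>S. v $ i) \<le> h / 2" using v unfolding An_cell_def h by (auto simp: mult.commute)
  ultimately have uv': "- h \<le> (\<Sum>i\<in>S. (u - v) $ i)" by (simp add: sum_subtractf)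
  let ?y = "An_dual_proj (\<lambda>i. of_bool (i \<in> S)) :: real ^ 'n"
  have "(\<Sum>i\<in>S. x $ i) - h \<le> (\<Sum>i\<in>S. x $ i) + (\<Sum>i\<in>S. (u - v) $ i)" using uv' by simp
  also have "\<dots> = (x + (u - v)) \<bullet> ?y"
    unfolding inner_add_left using inner_An_dual_proj_indicator x(1) sum_zero_diff[OF uv] by metis
  also have "\<dots> \<le> norm (x + (u - v)) * norm ?y" by (rule norm_cauchy_schwarz)
  finally have "((\<Sum>i\<in>S. x $ i) - h)\<^sup>2 \<le> (norm (x + (u - v)) * norm ?y)\<^sup>2"
    using x(2) by (intro power_mono) auto
  then show ?thesis unfolding power_mult_distrib norm_An_dual_proj_indicator h .
qed

section \<open>The sublattice of index 140 in the dual of \<open>A\<^sub>5\<close>\<close>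

lemma exhaust_6: "x = 1 \<or> x = 2 \<or> x = 3 \<or> x = 4 \<or> x = 5 \<or> x = 6" for x :: 6
proof (induct x)
  case (of_int z)
  then have "z = 0 \<or> z = 1 \<or> z = 2 \<or> z = 3 \<or> z = 4 \<or> z = 5" by fastforce
  then show ?case by auto
qed

lemma UNIV_6: "UNIV = {1, 2, 3, 4, 5, 6 :: 6}"
  using exhaust_6 by auto

lemma sum_6: "sum f (UNIV :: 6 set) = f 1 + f 2 + f 3 + f 4 + f 5 + f 6"
  unfolding UNIV_6 by (simp add: ac_simps)

text \<open>The kernel of the colouring \<open>A5_color\<close> is a sublattice of index \<open>7 \<cdot> 5 \<cdot> 2 \<cdot> 2 = 140\<close>. Its short vectors are
  separated from the doubled cell by the functional given by the coordinates that exceed the least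
  one by at least 2.\<close>

definition A5_far :: "int \<Rightarrow> int \<Rightarrow> int \<Rightarrow> int \<Rightarrow> int \<Rightarrow> int \<Rightarrow> bool" where
  "A5_far a b c d e f = (let g = (\<lambda>x. if 2 \<le> x then 1 else 0);
     s = g a + g b + g c + g d + g e + g f;
     q = g a * a + g b * b + g c * c + g d * d + g e * e + g f * f;
     t = a + b + c + d + e + f;
     n = a * a + b * b + c * c + d * d + e * e + f * f;
     r = 6 * q - s * t - s * (6 - s)
   in 47 \<le> 6 * n - t * t \<or> 0 < r \<and> 294 * (s * (6 - s)) < 25 * (r * r))"

text \<open>Representatives have least coordinate 0, and a coordinate above 3 makes the vector long,
  so finitely many tuples remain. The loops over \<open>a\<close>, \<open>c\<close>,
  \<open>d\<close> are outermost because the congruence modulo 7 involves only these and prunes the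
  search early.\<close>

definition A5_check :: bool where
  "A5_check = list_all (\<lambda>a. list_all (\<lambda>c. list_all (\<lambda>d. if (2 * a + 4 * c + d) mod 7 \<noteq> 0 then True
     else list_all (\<lambda>b. list_all (\<lambda>e. if (b + e) mod 2 \<noteq> 0 then True
     else list_all (\<lambda>f. if (e + f) mod 2 \<noteq> 0 then True
       else if (2 * (a + b + e + f) + 3 * c + 4 * d) mod 5 \<noteq> 0 then True
       else if a \<noteq> 0 \<and> b \<noteq> 0 \<and> c \<noteq> 0 \<and> d \<noteq> 0 \<and> e \<noteq> 0 \<and> f \<noteq> 0 then True
       else if a = 0 \<and> b = 0 \<and> c = 0 \<and> d = 0 \<and> e = 0 \<and> f = 0 then True
       else A5_far a b c d e f) [0, 1, 2, 3 :: int])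
     [0, 1, 2, 3]) [0, 1, 2, 3]) [0, 1, 2, 3]) [0, 1, 2, 3]) [0, 1, 2, 3]"

lemma A5_check: A5_check
  by code_simp

lemma A5_checkD:
  assumes a: "0 \<le> a" "a \<le> 3" and b: "0 \<le> b" "b \<le> 3" and c: "0 \<le> c" "c \<le> 3"
    and d: "0 \<le> d" "d \<le> 3" and e: "0 \<le> e" "e \<le> 3" and f: "0 \<le> f" "f \<le> 3"
    and mods: "(2 * a + 4 * c + d) mod 7 = 0" "(2 * (a + b + e + f) + 3 * c + 4 * d) mod 5 = 0"
      "(b + e) mod 2 = 0" "(e + f) mod 2 = 0"
    and zero: "a = 0 \<or> b = 0 \<or> c = 0 \<or> d = 0 \<or> e = 0 \<or> f = 0"
  shows "a = 0 \<and> b = 0 \<and> c = 0 \<and> d = 0 \<and> e = 0 \<and> f = 0 \<or> A5_far a b c d e f"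
proof -
  have mem: "x \<in> set [0, 1, 2, 3]" if "0 \<le> x" "x \<le> 3" for x :: int
    using that by auto
  note * = A5_check[unfolded A5_check_def list_all_iff, THEN bspec, OF mem[OF a],
      THEN bspec, OF mem[OF c], THEN bspec, OF mem[OF d]]
  have "\<forall>b\<in>set [0, 1, 2, 3]. \<forall>e\<in>set [0, 1, 2, 3]. if (b + e) mod 2 \<noteq> 0 then True
     else \<forall>f\<in>set [0, 1, 2, 3]. if (e + f) mod 2 \<noteq> 0 then True
       else if (2 * (a + b + e + f) + 3 * c + 4 * d) mod 5 \<noteq> 0 then True
       else if a \<noteq> 0 \<and> b \<noteq> 0 \<and> c \<noteq> 0 \<and> d \<noteq> 0 \<and> e \<noteq> 0 \<and> f \<noteq> 0 then True
       else if a = 0 \<and> b = 0 \<and> c = 0 \<and> d = 0 \<and> e = 0 \<and> f = 0 then True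
       else A5_far a b c d e f"
    using * mods(1) by (simp only: if_False not_not simp_thms)
  from this[THEN bspec, OF mem[OF b], THEN bspec, OF mem[OF e]]
  have "\<forall>f\<in>set [0, 1, 2, 3]. if (e + f) mod 2 \<noteq> 0 then True
       else if (2 * (a + b + e + f) + 3 * c + 4 * d) mod 5 \<noteq> 0 then True
       else if a \<noteq> 0 \<and> b \<noteq> 0 \<and> c \<noteq> 0 \<and> d \<noteq> 0 \<and> e \<noteq> 0 \<and> f \<noteq> 0 then True
       else if a = 0 \<and> b = 0 \<and> c = 0 \<and> d = 0 \<and> e = 0 \<and> f = 0 then True
       else A5_far a b c d e f"
    using mods(3) by (simp only: if_False not_not simp_thms)
  from this[THEN bspec, OF mem[OF f]]
  show ?thesis using mods zero by argo
qed

text \<open>The coefficients of the four forms sum to 7, 15, 2 and 2, multiples of the moduli. Hence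
  the colour is invariant under adding (1, ..., 1) and descends to the projected lattice.\<close>

definition A5_color :: "(6 \<Rightarrow> int) \<Rightarrow> nat" where
  "A5_color z = nat ((2 * z 1 + 4 * z 3 + z 4) mod 7
     + 7 * ((2 * (z 1 + z 2 + z 5 + z 6) + 3 * z 3 + 4 * z 4) mod 5
     + 5 * ((z 2 + z 5) mod 2 + 2 * ((z 5 + z 6) mod 2))))"

lemma A5_color_less: "A5_color z < 140"
proof -
  have "(2 * z 1 + 4 * z 3 + z 4) mod 7 \<le> 6" "(2 * (z 1 + z 2 + z 5 + z 6) + 3 * z 3 + 4 * z 4) mod 5 \<le> 4"
    "(z 2 + z 5) mod 2 \<le> 1" "(z 5 + z 6) mod 2 \<le> 1"
    using pos_mod_bound[of 7 "2 * z 1 + 4 * z 3 + z 4"]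
      pos_mod_bound[of 5 "2 * (z 1 + z 2 + z 5 + z 6) + 3 * z 3 + 4 * z 4"]
      pos_mod_bound[of 2 "z 2 + z 5"] pos_mod_bound[of 2 "z 5 + z 6"] by simp_all
  then have "(2 * z 1 + 4 * z 3 + z 4) mod 7
     + 7 * ((2 * (z 1 + z 2 + z 5 + z 6) + 3 * z 3 + 4 * z 4) mod 5
     + 5 * ((z 2 + z 5) mod 2 + 2 * ((z 5 + z 6) mod 2))) \<le> 6 + 7 * (4 + 5 * (1 + 2 * 1))"
    by (intro add_mono mult_left_mono) simp_all
  then have "A5_color z \<le> 139" unfolding A5_color_def by (simp only: nat_le_iff) simp
  then show ?thesis by simp
qed

lemma A5_color_eq:
  assumes eq: "A5_color z = A5_color z'"
  defines "w \<equiv> \<lambda>i. z i - z' i"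
  shows "7 dvd 2 * w 1 + 4 * w 3 + w 4" "5 dvd 2 * (w 1 + w 2 + w 5 + w 6) + 3 * w 3 + 4 * w 4"
    "2 dvd w 2 + w 5" "2 dvd w 5 + w 6"
proof -
  have nonneg: "0 \<le> a mod 7 + 7 * (b mod 5 + 5 * (c mod 2 + 2 * (d mod 2)))" for a b c d :: int
    by (intro add_nonneg_nonneg mult_nonneg_nonneg) simp_all
  have digits: "0 \<le> a mod 7" "a mod 7 < 7" "0 \<le> a mod 5" "a mod 5 < 5" "0 \<le> a mod 2" "a mod 2 < 2" for a :: int
    by simp_all
  note 0 = eq[unfolded A5_color_def, THEN eq_nat_nat_iff[OF nonneg nonneg, THEN iffD1]]
  note 1 = base_digit[OF digits(1,2) digits(1,2) 0]
  note 2 = base_digit[OF digits(3,4) digits(3,4) 1(2)]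
  note 3 = base_digit[OF digits(5,6) digits(5,6) 2(2)]
  have 4: "(z 5 + z 6) mod 2 = (z' 5 + z' 6) mod 2" using 3(2) by simp
  show "7 dvd 2 * w 1 + 4 * w 3 + w 4"
    using 1(1) unfolding mod_eq_dvd_iff w_def by (simp add: algebra_simps)
  show "5 dvd 2 * (w 1 + w 2 + w 5 + w 6) + 3 * w 3 + 4 * w 4"
    using 2(1) unfolding mod_eq_dvd_iff w_def by (simp add: algebra_simps)
  show "2 dvd w 2 + w 5"
    using 3(1) unfolding mod_eq_dvd_iff w_def by (simp add: algebra_simps)
  show "2 dvd w 5 + w 6"
    using 4 unfolding mod_eq_dvd_iff w_def by (simp add: algebra_simps)
qed

lemma An_dual_proj_shift: "An_dual_proj (\<lambda>i. w i - c) = An_dual_proj w"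
  unfolding An_dual_proj_def vec_eq_iff by (simp add: sum_subtractf diff_divide_distrib)

text \<open>\<open>An_cell_norm\<close> bounds the squared norm by 35/72, and 0.6973 slightly
  exceeds the square root of this.\<close>

lemma A5_cell_diff:
  fixes u v :: "real ^ 6"
  assumes "u \<in> An_cell" "v \<in> An_cell"
  shows "norm (u - v) \<le> 6973 / 5000"
proof -
  have "norm w \<le> 6973 / 10000" if "w \<in> An_cell" for w :: "real ^ 6"
  proof (rule power2_le_imp_le)
    show "(norm w)\<^sup>2 \<le> (6973 / 10000)\<^sup>2"
      using An_cell_norm[OF that] by (simp add: power2_eq_square)
  qed simp
  from this[OF assms(1)] this[OF assms(2)] show ?thesis
    using norm_triangle_ineq4[of u v] by simp
qed

lemma A5_separation:
  fixes u v :: "real ^ 6" and w :: "6 \<Rightarrow> int"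
  assumes u: "u \<in> An_cell" and v: "v \<in> An_cell" and ne: "An_dual_proj w \<noteq> 0"
    and w: "7 dvd 2 * w 1 + 4 * w 3 + w 4" "5 dvd 2 * (w 1 + w 2 + w 5 + w 6) + 3 * w 3 + 4 * w 4"
      "2 dvd w 2 + w 5" "2 dvd w 5 + w 6"
  shows "(norm (An_dual_proj w + (u - v)))\<^sup>2 > 49 / 25"
proof -
  \<comment> \<open>Subtracting the minimum changes neither the projection nor the four
    congruences.\<close>
  define \<mu> where "\<mu> = Min (range w)"
  define y where "y i = w i - \<mu>" for i
  have y0: "0 \<le> y i" for i unfolding y_def \<mu>_def by simp
  have "\<mu> \<in> range w" unfolding \<mu>_def by (rule Min_in) auto
  then obtain k where k: "y k = 0" unfolding y_def by auto
  define x where "x = An_dual_proj y"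
  have x: "An_dual_proj w = x" unfolding x_def y_def by (rule An_dual_proj_shift[symmetric])
  \<comment> \<open>For long vectors the triangle inequality suffices: sqrt (47/6) > 2.798, and
    2.798 - 1.3946 > 7/5.\<close>
  have far: ?thesis if "47 / 6 \<le> (norm x)\<^sup>2"
  proof -
    have "(2798 / 1000)\<^sup>2 \<le> (norm x)\<^sup>2" using that by (simp add: power2_eq_square)
    then have "2798 / 1000 \<le> norm x" by (rule power2_le_imp_le) simp
    then have "7/5 < norm (x + (u - v))"
      using A5_cell_diff[OF u v] norm_diff_ineq[of x "u - v"] by simp
    then have "(7/5)\<^sup>2 < (norm (x + (u - v)))\<^sup>2" by (rule power_strict_mono) simp_all
    then show ?thesis unfolding x by (simp add: power2_eq_square)
  qed
  show ?thesis
  proof (cases "\<exists>j. y j \<ge> 4")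
    case True
    then obtain j where j: "y j \<ge> 4" by blast
    have "x $ j - x $ k = y j" unfolding x_def An_dual_proj_def using k by simp
    then have "4 \<le> x $ j - x $ k" using j by simp
    moreover have "8 \<le> a\<^sup>2 + b\<^sup>2" if "4 \<le> a - b" for a b :: real
    proof -
      have "4\<^sup>2 \<le> (a - b)\<^sup>2" using that by (rule power_mono) simp
      also have "\<dots> \<le> (a - b)\<^sup>2 + (a + b)\<^sup>2" by simp
      also have "\<dots> = 2 * (a\<^sup>2 + b\<^sup>2)" by (simp add: power2_eq_square algebra_simps)
      finally show ?thesis by simp
    qed
    ultimately have "8 \<le> (x $ j)\<^sup>2 + (x $ k)\<^sup>2" by blast
    also have "\<dots> = (\<Sum>i\<in>{j, k}. (x $ i)\<^sup>2)"
    proof -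
      have "j \<noteq> k" using j k by auto
      then show ?thesis by simp
    qed
    also have "\<dots> \<le> (\<Sum>i\<in>UNIV. (x $ i)\<^sup>2)" by (rule sum_mono2) auto
    finally show ?thesis by (intro far) (simp add: norm_sq_vec)
  next
    case False
    have y3: "y i \<le> 3" for i
    proof -
      have "\<not> 4 \<le> y i" using False by blast
      then show ?thesis by simp
    qed
    have "2 * y 1 + 4 * y 3 + y 4 = (2 * w 1 + 4 * w 3 + w 4) - 7 * \<mu>" unfolding y_def by simp
    then have y7: "(2 * y 1 + 4 * y 3 + y 4) mod 7 = 0" 
      using w(1) by (simp only: dvd_eq_mod_eq_0[symmetric]) (intro dvd_diff dvd_triv_left)
    have "2 * (y 1 + y 2 + y 5 + y 6) + 3 * y 3 + 4 * y 4
        = (2 * (w 1 + w 2 + w 5 + w 6) + 3 * w 3 + 4 * w 4) - 5 * (3 * \<mu>)" unfolding y_def by simp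
    then have y5: "(2 * (y 1 + y 2 + y 5 + y 6) + 3 * y 3 + 4 * y 4) mod 5 = 0"
      using w(2) by (simp only: dvd_eq_mod_eq_0[symmetric]) (intro dvd_diff dvd_triv_left)
    have "y 2 + y 5 = (w 2 + w 5) - 2 * \<mu>" "y 5 + y 6 = (w 5 + w 6) - 2 * \<mu>" unfolding y_def by simp_all
    then have y2: "(y 2 + y 5) mod 2 = 0" "(y 5 + y 6) mod 2 = 0" 
      using w(3,4) by (simp_all only: dvd_eq_mod_eq_0[symmetric]) (intro dvd_diff dvd_triv_left, assumption)+
    have "y 1 = 0 \<or> y 2 = 0 \<or> y 3 = 0 \<or> y 4 = 0 \<or> y 5 = 0 \<or> y 6 = 0"
      using k exhaust_6[of k] by metis
    then have "y 1 = 0 \<and> y 2 = 0 \<and> y 3 = 0 \<and> y 4 = 0 \<and> y 5 = 0 \<and> y 6 = 0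
        \<or> A5_far (y 1) (y 2) (y 3) (y 4) (y 5) (y 6)"
      by (intro A5_checkD y0 y3 y7 y5 y2)
    moreover have False if "y 1 = 0 \<and> y 2 = 0 \<and> y 3 = 0 \<and> y 4 = 0 \<and> y 5 = 0 \<and> y 6 = 0"
    proof -
      have "y i = 0" for i using that exhaust_6[of i] by metis
      then have "x = 0" unfolding x_def An_dual_proj_def vec_eq_iff by simp
      then show False using ne x by simp
    qed
    ultimately have check: "A5_far (y 1) (y 2) (y 3) (y 4) (y 5) (y 6)" by blast
    define g :: "int \<Rightarrow> int" where "g t = (if 2 \<le> t then 1 else 0)" for t
    define S where "S = {i. 2 \<le> y i}"
    define s where "s = (\<Sum>i\<in>UNIV. g (y i))"
    define q where "q = (\<Sum>i\<in>UNIV. g (y i) * y i)"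
    define t where "t = (\<Sum>i\<in>UNIV. y i)"
    define n where "n = (\<Sum>i\<in>UNIV. y i * y i)"
    define r where "r = 6 * q - s * t - s * (6 - s)"
    have "47 \<le> 6 * n - t * t \<or> 0 < r \<and> 294 * (s * (6 - s)) < 25 * (r * r)"
      using check unfolding A5_far_def Let_def r_def s_def q_def t_def n_def sum_6 g_def .
    then show ?thesis
    proof
      assume "47 \<le> 6 * n - t * t"
      then have "real_of_int 47 \<le> of_int (6 * n - t * t)" by (simp only: of_int_le_iff)
      moreover have "6 * (norm x)\<^sup>2 = of_int (6 * n - t * t)"
        using norm_An_dual_proj[of y] unfolding x_def n_def t_def by (simp add: power2_eq_square)
      ultimately show ?thesis by (intro far) simp
    next
      assume r: "0 < r \<and> 294 * (s * (6 - s)) < 25 * (r * r)"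
      have card: "real (card S) = s"
        unfolding s_def g_def S_def by (simp add: sum.If_cases)
      define h where "h = real (card S) * (real CARD(6) - card S) / CARD(6)"
      have h: "h = s * (6 - s) / 6" unfolding h_def card by simp
      have "(\<Sum>i\<in>S. y i) = q"
        unfolding q_def S_def g_def by (intro sum.mono_neutral_cong_left) auto
      then have "(\<Sum>i\<in>S. x $ i) = q - s * (t / 6)"
        unfolding x_def An_dual_proj_def t_def[symmetric]
        by (simp add: sum_subtractf card flip: of_int_sum)
      then have xS: "(\<Sum>i\<in>S. x $ i) - h = r / 6"
        unfolding h r_def by (simp add: field_simps)
      have "((\<Sum>i\<in>S. x $ i) - h)\<^sup>2 \<le> (norm (x + (u - v)))\<^sup>2 * h"
        by (rule An_cell_separation[OF u v h_def])
          (use xS r in \<open>simp_all add: x_def An_dual_proj_sum_zero\<close>)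
      then have "(r / 6)\<^sup>2 \<le> (norm (x + (u - v)))\<^sup>2 * h" by (simp only: xS)
      then have "real_of_int (r * r) \<le> (norm (x + (u - v)))\<^sup>2 * (6 * of_int (s * (6 - s)))"
        unfolding h by (simp add: power_divide flip: power2_eq_square)
      moreover have "real_of_int (294 * (s * (6 - s))) < of_int (25 * (r * r))"
        using r by (simp only: of_int_less_iff)
      \<comment> \<open>The constant 294 is 150 times 49/25, the square of the avoided
        distance.\<close>
      moreover have "294 * P < (150 * N) * P" if "R \<le> N * (6 * P)" "294 * P < 25 * R" for N P R :: real
        using that by simp
      ultimately have lt: "294 * real_of_int (s * (6 - s)) < (150 * (norm (x + (u - v)))\<^sup>2) * of_int (s * (6 - s))"
        by (metis of_int_mult of_int_numeral)
      have "0 \<le> s * (6 - s)"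
      proof -
        have "card S \<le> 6" using card_mono[of "UNIV :: 6 set" S] by simp
        then have "0 \<le> s" "s \<le> 6" using card by linarith+
        then show ?thesis by simp
      qed
      then have "294 < 150 * (norm (x + (u - v)))\<^sup>2"
        using lt by (meson mult_right_less_imp_less of_int_0_le_iff)
      then show ?thesis unfolding x by simp
    qed
  qed
qed

theorem colorable_5: "unit_dist_colorable (UNIV :: (real ^ 5) set) 140"
proof -
  obtain z where z: "\<And>p :: real ^ 6. p \<in> sum_zero \<Longrightarrow> p - An_dual_proj (z p) \<in> An_cell"
    using An_cell_cover by metis
  have hyperplane: "(sum_zero :: (real ^ 6) set) = {x. (\<chi> i. 1) \<bullet> x = 0}"
    unfolding sum_zero_def inner_vec_def by simp
  have "((\<chi> i. 1) :: real ^ 6) \<noteq> 0" by (simp add: vec_eq_iff)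
  then have dim: "dim (sum_zero :: (real ^ 6) set) = 5"
    unfolding hyperplane by (subst dim_hyperplane) simp_all
  show ?thesis
  proof (rule unit_dist_colorable_transfer[where S = "sum_zero :: (real ^ 6) set" and D = "7/5" and c = "\<lambda>p. A5_color (z p)"])
    show "subspace (sum_zero :: (real ^ 6) set)" unfolding hyperplane by (rule subspace_hyperplane)
    show "dim (sum_zero :: (real ^ 6) set) = DIM(real ^ 5)" using dim by simp
    show "A5_color (z p) \<noteq> A5_color (z q)" if p: "p \<in> sum_zero" and q: "q \<in> sum_zero" and pq: "dist p q = 7/5" for p q
    proof
      assume eq: "A5_color (z p) = A5_color (z q)"
      define u where "u = p - An_dual_proj (z p)"
      define v where "v = q - An_dual_proj (z q)"
      have uv: "u \<in> An_cell" "v \<in> An_cell" unfolding u_def v_def using z p q by auto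
      have "p - q = (An_dual_proj (z p) - An_dual_proj (z q)) + (u - v)" unfolding u_def v_def by simp
      then have d: "norm (An_dual_proj (\<lambda>i. z p i - z q i) + (u - v)) = 7/5"
        using pq unfolding dist_norm An_dual_proj_diff by simp
      show False
      proof (cases "An_dual_proj (\<lambda>i. z p i - z q i) = 0")
        case True
        then show False using d A5_cell_diff[OF uv] by simp
      next
        case False
        then show False using A5_separation[OF uv False A5_color_eq[OF eq]] d by (simp add: power2_eq_square)
      qed
    qed
  qed (simp_all add: A5_color_less)
qed

theorem theorem1p1:
  shows "chromatic_number (UNIV :: (real ^ 5) set) \<le> 140 \<and>
         chromatic_number (UNIV :: (real ^ 7) set) \<le> 1372 \<and>
         chromatic_number (UNIV :: (real ^ 9) set) \<le> 17253"
proof -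
  have "unit_dist_colorable (UNIV :: (real ^ 7) set) (4 * 343)"
    by (rule E6.colorable_Times_real) simp
  then have 7: "unit_dist_colorable (UNIV :: (real ^ 7) set) 1372" by simp
  have "unit_dist_colorable (UNIV :: (real ^ 9) set) (4 * 2401)"
    by (rule E8.colorable_Times_real) simp
  then have 9: "unit_dist_colorable (UNIV :: (real ^ 9) set) 17253"
    by (rule unit_dist_colorable_mono) simp
  show ?thesis
    using chromatic_number_le[OF colorable_5] chromatic_number_le[OF 7] chromatic_number_le[OF 9]
    by (simp add: numeral_eq_enat)
qed

end
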